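(* Let $G$ be a connected nonbipartite graph with $n \geq 4$ vertices. Then $$Sz^*(G)-W(G) \geq \frac{n^2+4n-6}{4}.$$ Equality holds if and only if $G$ is composed of a cycle $C_3$ on $3$ vertices and a tree $T$ on $n-2$ vertices sharing a single vertex.
   Context: All graphs are finite, undirected and simple. For a connected graph $G$, $d_G(u,v)$ is the distance between $u$ and $v$ in $G$, and the Wiener index is $W(G)=\sum_{\{u,v\}\subseteq V(G)} d_G(u,v)$ (sum over unordered pairs of distinct vertices). For an edge $e=uv$ let $n_u(e)=|\{w\in V(G): d_G(u,w)<d_G(v,w)\}|$, $n_v(e)=|\{w\in V(G): d_G(v,w)<d_G(u,w)\}|$ and $n_0(e)=|\{w\in V(G): d_G(u,w)=d_G(v,w)\}|$. The revised Szeged index is $$Sz^*(G)=\sum_{e=uv\in E(G)}\left(n_u(e)+\frac{n_0(e)}{2}\right)\left(n_v(e)+\frac{n_0(e)}{2}\right).$$ "A cycle and a tree sharing a single vertex" means that $G$ is the union of the cycle and the tree, which have exactly one vertex (and no edge) in common. *)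

theory Defs
  imports Complex_Main "Graph_Theory.Digraph_Component"
begin

text \<open>
  A finite simple undirected graph is a \<open>pair_graph\<close> of the entry Graph_Theory: a finite, loopless,
  symmetric digraph without parallel arcs. An undirected edge \<open>uv\<close> thus appears as the two arcs
  \<open>(u, v)\<close> and \<open>(v, u)\<close>.
\<close>

text \<open>The least length of a walk. It is unspecified if \<open>v\<close> is not reachable from \<open>u\<close>.\<close>

definition graph_dist :: "'a pair_pre_digraph \<Rightarrow> 'a \<Rightarrow> 'a \<Rightarrow> nat" where
  "graph_dist G u v = (LEAST k. \<exists>p. pre_digraph.awalk (with_proj G) u p v \<and> length p = k)"

text \<open>
  The sum ranges over ordered pairs, so each unordered pair of distinct vertices is counted twice;
  the factor \<open>1/2\<close> compensates.
\<close>

definition wiener_index :: "'a pair_pre_digraph \<Rightarrow> real" where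
  "wiener_index G =
    (1/2) * (\<Sum>(u, v) \<in> {(u, v). u \<in> pverts G \<and> v \<in> pverts G \<and> u \<noteq> v}. real (graph_dist G u v))"

text \<open>For an edge \<open>e = uv\<close>, \<open>closer_count G u v\<close> is \<open>n\<^sub>u(e)\<close> and \<open>closer_count G v u\<close> is \<open>n\<^sub>v(e)\<close>.\<close>

definition closer_count :: "'a pair_pre_digraph \<Rightarrow> 'a \<Rightarrow> 'a \<Rightarrow> nat" where
  "closer_count G u v = card {w \<in> pverts G. graph_dist G u w < graph_dist G v w}"

definition equidistant_count :: "'a pair_pre_digraph \<Rightarrow> 'a \<Rightarrow> 'a \<Rightarrow> nat" where
  "equidistant_count G u v = card {w \<in> pverts G. graph_dist G u w = graph_dist G v w}"

text \<open>
  The summand is symmetric in \<open>u\<close> and \<open>v\<close>; the factor \<open>1/2\<close> accounts for the two arcs of each edge.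
\<close>

definition revised_szeged_index :: "'a pair_pre_digraph \<Rightarrow> real" where
  "revised_szeged_index G =
    (1/2) * (\<Sum>(u, v) \<in> parcs G.
      (real (closer_count G u v) + real (equidistant_count G u v) / 2) *
      (real (closer_count G v u) + real (equidistant_count G u v) / 2))"

definition bipartite_graph :: "'a pair_pre_digraph \<Rightarrow> bool" where
  "bipartite_graph G \<longleftrightarrow>
    (\<exists>A B. A \<union> B = pverts G \<and> A \<inter> B = {} \<and>
      (\<forall>(u, v) \<in> parcs G. (u \<in> A \<and> v \<in> B) \<or> (u \<in> B \<and> v \<in> A)))"

text \<open>
  In a symmetric digraph the closed walk along \<open>(u, v)\<close> and back along \<open>(v, u)\<close> satisfies
  \<open>pre_digraph.cycle\<close>. Undirected cycles are the directed ones of length at least 3. For the same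
  reason the library predicates \<open>forest\<close> and \<open>tree\<close>, which are about directed cycles, do not
  describe undirected forests and trees.
\<close>

definition undirected_cycle :: "'a pair_pre_digraph \<Rightarrow> ('a \<times> 'a) awalk \<Rightarrow> bool" where
  "undirected_cycle G p \<longleftrightarrow> pre_digraph.cycle (with_proj G) p \<and> 3 \<le> length p"

definition cycle_graph :: "nat \<Rightarrow> 'a pair_pre_digraph \<Rightarrow> bool" where
  "cycle_graph k G \<longleftrightarrow> pair_graph G \<and>
    (\<exists>p. undirected_cycle G p \<and> length p = k \<and>
      pverts G = fst ` set p \<and> parcs G = set p \<union> converse (set p))"

definition tree_graph :: "'a pair_pre_digraph \<Rightarrow> bool" where
  "tree_graph G \<longleftrightarrow> pair_graph G \<and> Digraph_Component.connected (with_proj G) \<and>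
    (\<nexists>p. undirected_cycle G p)"

definition union_sharing_one_vertex ::
    "'a pair_pre_digraph \<Rightarrow> 'a pair_pre_digraph \<Rightarrow> 'a pair_pre_digraph \<Rightarrow> bool" where
  "union_sharing_one_vertex G H K \<longleftrightarrow>
    with_proj G = Digraph_Component.union (with_proj H) (with_proj K) \<and>
    (\<exists>v. pverts H \<inter> pverts K = {v}) \<and> parcs H \<inter> parcs K = {}"

end

theory Submission
  imports Defs
begin

text \<open>
  Expanding the products in \<open>Sz\<^sup>*\<close> gives a sum over ordered pairs \<open>(x, y)\<close> of vertices: an arc that
  strictly separates \<open>x\<close> from \<open>y\<close> contributes \<open>1\<close>, and an arc that is horizontal to \<open>x\<close> or to \<open>y\<close>,
  that is, has its ends at equal distance, contributes \<open>1/4\<close>. The arcs of a geodesic from \<open>x\<close> to \<open>y\<close>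
  separate, so they pay for \<open>d(x, y)\<close>. What remains is at least \<open>|H(x) \<union> H(y)| / 4\<close>, where the set \<open>H(x)\<close>
  of horizontal arcs is nonempty because \<open>G\<close> is not bipartite; this is at least \<open>1/2\<close>, and at least \<open>1\<close>
  if \<open>H(x) \<noteq> H(y)\<close>. If \<open>uv\<close> is horizontal to \<open>x\<close> with \<open>d(x, u)\<close> minimal over all such choices, then
  \<open>x\<close>, \<open>u\<close>, \<open>v\<close> have pairwise distinct sets \<open>H\<close>, so there are at least \<open>4n - 6\<close> ordered pairs of the second
  kind. Equality forces every \<open>H(x)\<close> to be a single edge, geodesics to be unique, and all but two vertices
  to share the same \<open>H\<close>; this leaves a triangle on \<open>x\<close>, \<open>u\<close>, \<open>v\<close> with two vertices of degree 2.
  Conversely, a triangle and a tree together have \<open>n\<close> edges, which makes all predecessors on geodesics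
  unique and every \<open>H(x)\<close> a single edge.
\<close>

section \<open>Distances in a connected graph\<close>

locale connected_pair_graph = pair_graph G for G :: "'a pair_pre_digraph" +
  assumes conn: "Digraph_Component.connected (with_proj G)"
begin

abbreviation V :: "'a set" where "V \<equiv> pverts G"
abbreviation E :: "('a \<times> 'a) set" where "E \<equiv> parcs G"
abbreviation d :: "'a \<Rightarrow> 'a \<Rightarrow> nat" where "d \<equiv> graph_dist G"

text \<open>Powers of the arc relation stand in for walks from here on, so that walks are joined,
  reversed and cut by the rules for \<open>relpow\<close>.\<close>

lemma awalk_iff_relpow:
  assumes "u \<in> V"
  shows "(\<exists>p. awalk u p v \<and> length p = k) \<longleftrightarrow> (u, v) \<in> E ^^ k"
  using assms
proof (induction k arbitrary: u)
  case 0
  then show ?case by (auto simp: awalk_Nil_iff)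
next
  case (Suc k)
  have "(\<exists>p. awalk u p v \<and> length p = Suc k) \<longleftrightarrow>
      (\<exists>w. (u, w) \<in> E \<and> (\<exists>p. awalk w p v \<and> length p = k))"
  proof
    assume "\<exists>p. awalk u p v \<and> length p = Suc k"
    then obtain e p where "awalk u (e # p) v" "length p = k"
      by (metis length_Suc_conv)
    then show "\<exists>w. (u, w) \<in> E \<and> (\<exists>p. awalk w p v \<and> length p = k)"
      by (cases e) (auto simp: awalk_Cons_iff)
  next
    assume "\<exists>w. (u, w) \<in> E \<and> (\<exists>p. awalk w p v \<and> length p = k)"
    then obtain w p where "(u, w) \<in> E" "awalk w p v" "length p = k" by blast
    then have "awalk u ((u, w) # p) v" "length ((u, w) # p) = Suc k"
      by (auto simp: awalk_Cons_iff)
    then show "\<exists>p. awalk u p v \<and> length p = Suc k" by blast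
  qed
  also have "\<dots> \<longleftrightarrow> (\<exists>w. (u, w) \<in> E \<and> (w, v) \<in> E ^^ k)"
    using Suc.IH in_arcsD2 by blast
  also have "\<dots> \<longleftrightarrow> (u, v) \<in> E ^^ Suc k"
    by (metis relpow_Suc_D2 relpow_Suc_I2)
  finally show ?case .
qed

lemma dist_eq_Least: "u \<in> V \<Longrightarrow> d u v = (LEAST k. (u, v) \<in> E ^^ k)"
  by (simp add: graph_dist_def awalk_iff_relpow)

lemma reachable_in_graph:
  assumes "u \<in> V" "v \<in> V"
  shows "(u, v) \<in> E\<^sup>*"
proof -
  have "strongly_connected (with_proj G)"
    using symmetric_connected_imp_strongly_connected[OF _ conn] sym_arcs by blast
  then have "u \<rightarrow>\<^sup>*\<^bsub>with_proj G\<^esub> v" using assms by auto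
  then show ?thesis
    by (simp add: reachable_def rtrancl_on_rtranclI)
qed

lemma dist_relpow: "u \<in> V \<Longrightarrow> v \<in> V \<Longrightarrow> (u, v) \<in> E ^^ d u v"
  using rtrancl_imp_relpow[OF reachable_in_graph[of u v]]
  by (metis dist_eq_Least LeastI)

lemma dist_le: "u \<in> V \<Longrightarrow> (u, v) \<in> E ^^ k \<Longrightarrow> d u v \<le> k"
  by (simp add: dist_eq_Least Least_le)

lemma dist_self [simp]: "u \<in> V \<Longrightarrow> d u u = 0"
  using dist_le[of u u 0] by simp

lemma dist_eq_0_iff [simp]: "u \<in> V \<Longrightarrow> v \<in> V \<Longrightarrow> d u v = 0 \<longleftrightarrow> u = v"
  using dist_relpow[of u v] by auto

lemma dist_triangle:
  assumes "u \<in> V" "v \<in> V" "w \<in> V"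
  shows "d u w \<le> d u v + d v w"
  using dist_relpow[of u v] dist_relpow[of v w] assms
  by (intro dist_le) (auto simp: relpow_add)

lemma relpow_sym: "(u, v) \<in> E ^^ k \<Longrightarrow> (v, u) \<in> E ^^ k"
proof (induction k arbitrary: v)
  case (Suc k)
  then obtain w where "(u, w) \<in> E ^^ k" "(w, v) \<in> E" by auto
  then have "(v, w) \<in> E" "(w, u) \<in> E ^^ k" using Suc.IH arcs_symmetric by auto
  then show ?case by (rule relpow_Suc_I2)
qed simp

lemma dist_sym:
  assumes "u \<in> V" "v \<in> V"
  shows "d u v = d v u"
  using assms by (meson antisym dist_le relpow_sym dist_relpow)

lemma dist_eq_1_iff:
  assumes "u \<in> V" "v \<in> V"
  shows "d u v = 1 \<longleftrightarrow> (u, v) \<in> E"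
proof
  assume "d u v = 1"
  then show "(u, v) \<in> E" using dist_relpow[of u v] assms by simp
next
  assume "(u, v) \<in> E"
  then have "d u v \<le> 1" "u \<noteq> v" using dist_le[of u v 1] assms no_loops' by auto
  then show "d u v = 1" using dist_eq_0_iff[OF assms] by linarith
qed

lemma dist_arc:
  assumes "(u, v) \<in> E" "x \<in> V"
  shows "d x u \<le> Suc (d x v)" "d x v \<le> Suc (d x u)"
proof -
  have uv: "u \<in> V" "v \<in> V" using assms in_arcsD1 in_arcsD2 by auto
  then have "d u v = 1" "d v u = 1" using assms dist_eq_1_iff dist_sym by auto
  then show "d x u \<le> Suc (d x v)" "d x v \<le> Suc (d x u)"
    using dist_triangle[of x v u] dist_triangle[of x u v] uv assms by auto
qed

lemma dist_predecessor:
  assumes "x \<in> V" "v \<in> V" "x \<noteq> v"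
  obtains z where "(z, v) \<in> E" "d x v = Suc (d x z)"
proof -
  obtain k where k: "d x v = Suc k"
    using assms dist_eq_0_iff[of x v] not0_implies_Suc by blast
  then obtain z where z: "(x, z) \<in> E ^^ k" "(z, v) \<in> E"
    using dist_relpow[of x v] assms by auto
  have "d x z \<le> k" using z assms by (intro dist_le)
  moreover have "d x v \<le> Suc (d x z)" using z assms dist_arc by blast
  ultimately show ?thesis using that z k by simp
qed

section \<open>Horizontal and separating arcs\<close>

definition horizontal :: "'a \<Rightarrow> ('a \<times> 'a) set" where
  "horizontal x = {(u, v) \<in> E. d x u = d x v}"

definition separating :: "'a \<Rightarrow> 'a \<Rightarrow> ('a \<times> 'a) set" where
  "separating x y = {(u, v) \<in> E. d x u < d x v \<and> d y v < d y u}"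

lemma finite_horizontal [simp]: "finite (horizontal x)"
  by (rule finite_subset[of _ E]) (auto simp: horizontal_def)

lemma finite_separating [simp]: "finite (separating x y)"
  by (rule finite_subset[of _ E]) (auto simp: separating_def)

text \<open>The share of the vertex \<open>x\<close> in the factor \<open>n_u(e) + n_0(e)/2\<close>
  for \<open>e = uv\<close>. Writing both factors as sums over vertices turns their product into a
  sum over ordered pairs.\<close>

definition side :: "'a \<Rightarrow> 'a \<Rightarrow> 'a \<Rightarrow> real" where
  "side u v x = (if d x u < d x v then 1 else if d x u = d x v then 1/2 else 0)"

lemma sum_side:
  assumes "u \<in> V" "v \<in> V"
  shows "(\<Sum>x\<in>V. side u v x) = real (closer_count G u v) + real (equidistant_count G u v) / 2"
proof -
  have "(\<Sum>x\<in>V. side u v x) =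
      (\<Sum>x\<in>V. (if d x u < d x v then 1 else 0) + (if d x u = d x v then 1 else 0) / 2)"
    by (intro sum.cong) (auto simp: side_def)
  also have "\<dots> = real (card {x \<in> V. d x u < d x v}) + real (card {x \<in> V. d x u = d x v}) / 2"
    by (simp add: sum.distrib sum.If_cases sum_divide_distrib[symmetric] Int_def)
  also have "{x \<in> V. d x u < d x v} = {x \<in> V. d u x < d v x}"
    using assms dist_sym by auto
  also have "{x \<in> V. d x u = d x v} = {x \<in> V. d u x = d v x}"
    using assms dist_sym by auto
  finally show ?thesis by (simp add: closer_count_def equidistant_count_def)
qed

lemma sum_arcs_swap: "(\<Sum>(u, v)\<in>E. f u v) = (\<Sum>(u, v)\<in>E. f v u)"
  by (rule sum.reindex_bij_witness[of _ prod.swap prod.swap]) (auto intro: arcs_symmetric)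

text \<open>Adding each summand to its mirror image under \<open>(u, v) \<mapsto> (v, u)\<close>
  leaves three values: 1 if the arc or its reversal separates, 1/2 if it is horizontal to
  \<open>x\<close> or \<open>y\<close>, and 0 otherwise. Halving gives the weights 1 and
  1/4.\<close>

lemma sum_arcs_side:
  "(\<Sum>(u, v)\<in>E. side u v x * side v u y) =
    real (card (separating x y)) + real (card (horizontal x \<union> horizontal y)) / 4"
proof -
  let ?sep = "\<lambda>u v. if (u, v) \<in> separating x y then 1 else 0 :: real"
  let ?hor = "\<lambda>u v. if (u, v) \<in> horizontal x \<union> horizontal y then 1 else 0 :: real"
  have "2 * (\<Sum>(u, v)\<in>E. side u v x * side v u y) =
      (\<Sum>(u, v)\<in>E. side u v x * side v u y + side v u x * side u v y)"
    using sum_arcs_swap[of "\<lambda>u v. side u v x * side v u y"]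
    by (simp add: sum.distrib case_prod_beta)
  also have "\<dots> = (\<Sum>(u, v)\<in>E. ?sep u v + ?sep v u + ?hor u v / 2)"
    by (intro sum.cong)
      (auto simp: side_def separating_def horizontal_def arcs_symmetric)
  also have "\<dots> = 2 * (\<Sum>(u, v)\<in>E. ?sep u v) + (\<Sum>(u, v)\<in>E. ?hor u v) / 2"
    using sum_arcs_swap[of ?sep]
    by (simp add: sum.distrib case_prod_beta sum_divide_distrib)
  also have "(\<Sum>(u, v)\<in>E. ?sep u v) = real (card (separating x y))"
  proof -
    have "separating x y \<subseteq> E" by (auto simp: separating_def)
    then show ?thesis
      by (simp add: case_prod_beta sum.If_cases Int_absorb1)
  qed
  also have "(\<Sum>(u, v)\<in>E. ?hor u v) = real (card (horizontal x \<union> horizontal y))"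
  proof -
    have "horizontal x \<union> horizontal y \<subseteq> E" by (auto simp: horizontal_def)
    then have "(\<Sum>e\<in>horizontal x \<union> horizontal y. 1) = (\<Sum>(u, v)\<in>E. ?hor u v)"
      by (intro sum.mono_neutral_cong_left) auto
    then show ?thesis by simp
  qed
  finally show ?thesis by simp
qed

lemma revised_szeged_eq:
  "revised_szeged_index G = (1/2) * (\<Sum>(x, y)\<in>V \<times> V.
    real (card (separating x y)) + real (card (horizontal x \<union> horizontal y)) / 4)"
proof -
  have "revised_szeged_index G = (1/2) * (\<Sum>(u, v)\<in>E. \<Sum>(x, y)\<in>V \<times> V. side u v x * side v u y)"
  proof -
    have "(real (closer_count G u v) + real (equidistant_count G u v) / 2) *
      (real (closer_count G v u) + real (equidistant_count G u v) / 2) =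
      (\<Sum>(x, y)\<in>V \<times> V. side u v x * side v u y)" if "(u, v) \<in> E" for u v
    proof -
      have uv: "u \<in> V" "v \<in> V" using that in_arcsD1 in_arcsD2 by auto
      have "equidistant_count G u v = equidistant_count G v u"
        unfolding equidistant_count_def by metis
      then have "(real (closer_count G u v) + real (equidistant_count G u v) / 2) *
          (real (closer_count G v u) + real (equidistant_count G u v) / 2) =
        (\<Sum>x\<in>V. side u v x) * (\<Sum>x\<in>V. side v u x)"
        using sum_side[OF uv] sum_side[OF uv(2,1)] by simp
      also have "\<dots> = (\<Sum>(x, y)\<in>V \<times> V. side u v x * side v u y)"
        by (simp only: sum_product sum.cartesian_product)
      finally show ?thesis .
    qed
    then show ?thesis
      unfolding revised_szeged_index_def by (intro arg_cong[of _ _ "(*) (1/2)"] sum.cong) auto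
  qed
  also have "(\<Sum>(u, v)\<in>E. \<Sum>(x, y)\<in>V \<times> V. side u v x * side v u y) =
      (\<Sum>(x, y)\<in>V \<times> V. \<Sum>(u, v)\<in>E. side u v x * side v u y)"
    unfolding case_prod_unfold by (rule sum.swap)
  finally show ?thesis by (simp only: sum_arcs_side)
qed

lemma wiener_eq: "wiener_index G = (1/2) * (\<Sum>(x, y)\<in>V \<times> V. real (d x y))"
proof -
  have "(\<Sum>(x, y) \<in> {(x, y). x \<in> V \<and> y \<in> V \<and> x \<noteq> y}. real (d x y)) = (\<Sum>(x, y)\<in>V \<times> V. real (d x y))"
    by (rule sum.mono_neutral_left) (auto simp: dist_self)
  then show ?thesis by (simp add: wiener_index_def)
qed

lemma difference_eq:
  "revised_szeged_index G - wiener_index G = (1/2) * (\<Sum>(x, y)\<in>V \<times> V.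
    real (card (separating x y)) - real (d x y) + real (card (horizontal x \<union> horizontal y)) / 4)"
  unfolding revised_szeged_eq wiener_eq right_diff_distrib[symmetric] sum_subtractf[symmetric]
  by (intro arg_cong[of _ _ "(*) (1/2)"] sum.cong) auto

lemma horizontal_swap: "(u, v) \<in> horizontal x \<Longrightarrow> (v, u) \<in> horizontal x"
  by (auto simp: horizontal_def arcs_symmetric)

text \<open>A new arc brings its reversal along, and the two differ because there are no
  loops.\<close>

lemma card_symmetric_psubset:
  assumes "A \<subset> B" "B \<subseteq> E"
    and symA: "\<And>u v. (u, v) \<in> A \<Longrightarrow> (v, u) \<in> A"
    and symB: "\<And>u v. (u, v) \<in> B \<Longrightarrow> (v, u) \<in> B"
  shows "card A + 2 \<le> card B"
proof -
  have fin: "finite B" using assms(2) finite_arcs finite_subset by blast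
  obtain u v where uv: "(u, v) \<in> B" "(u, v) \<notin> A" using assms(1) by auto
  then have "{(u, v), (v, u)} \<subseteq> B - A" using symA symB by blast
  moreover have "u \<noteq> v" using uv assms(2) no_loops' by blast
  ultimately have "2 \<le> card (B - A)"
    using card_mono[of "B - A" "{(u, v), (v, u)}"] fin by auto
  moreover have "card B = card A + card (B - A)"
    using assms(1) fin card_mono[of B A] by (simp add: card_Diff_subset finite_subset[of A B] psubset_imp_subset)
  ultimately show ?thesis by simp
qed

lemma card_horizontal_ge:
  assumes "horizontal x \<noteq> {}"
  shows "2 \<le> card (horizontal x)"
proof -
  have "card ({} :: ('a \<times> 'a) set) + 2 \<le> card (horizontal x)"
  proof (rule card_symmetric_psubset)
    show "{} \<subset> horizontal x" using assms by blast
    show "horizontal x \<subseteq> E" by (auto simp: horizontal_def)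
  qed (use horizontal_swap in blast)+
  then show ?thesis by simp
qed

lemma card_horizontal_Un_ge:
  assumes "horizontal x \<noteq> {}" "horizontal y \<noteq> {}" "horizontal x \<noteq> horizontal y"
  shows "4 \<le> card (horizontal x \<union> horizontal y)"
proof -
  have sub: "horizontal x \<union> horizontal y \<subseteq> E" by (auto simp: horizontal_def)
  have "horizontal x \<subset> horizontal x \<union> horizontal y \<or> horizontal y \<subset> horizontal x \<union> horizontal y"
    using assms(3) by blast
  then have "card (horizontal x) + 2 \<le> card (horizontal x \<union> horizontal y) \<or>
      card (horizontal y) + 2 \<le> card (horizontal x \<union> horizontal y)"
    using card_symmetric_psubset[OF _ sub] horizontal_swap by (metis Un_iff)
  then show ?thesis using card_horizontal_ge assms by fastforce
qed

section \<open>Geodesic arcs and the lower bound on separating arcs\<close>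

definition geodesic_arcs :: "'a \<Rightarrow> 'a \<Rightarrow> ('a \<times> 'a) set" where
  "geodesic_arcs x y = {(u, v) \<in> E. d x y = Suc (d x u + d v y)}"

lemma finite_geodesic_arcs [simp]: "finite (geodesic_arcs x y)"
  by (rule finite_subset[of _ E]) (auto simp: geodesic_arcs_def)

text \<open>The triangle inequality through \<open>v\<close> puts \<open>u\<close> closer to
  \<open>x\<close>, and the one through \<open>u\<close> puts \<open>v\<close> closer to
  \<open>y\<close>. The converse needs a special graph, see
  \<open>separating_geodesic\<close>.\<close>

lemma geodesic_arcs_subset_separating:
  assumes "x \<in> V" "y \<in> V"
  shows "geodesic_arcs x y \<subseteq> separating x y"
proof clarify
  fix u v assume "(u, v) \<in> geodesic_arcs x y"
  then have uv: "(u, v) \<in> E" "d x y = Suc (d x u + d v y)" by (auto simp: geodesic_arcs_def)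
  then have V: "u \<in> V" "v \<in> V" using in_arcsD1 in_arcsD2 by auto
  have "d x y \<le> d x v + d v y" "d x y \<le> d x u + d u y"
    using dist_triangle V assms by auto
  then show "(u, v) \<in> separating x y"
    using uv V assms dist_sym[of y u] dist_sym[of y v] by (auto simp: separating_def)
qed

text \<open>The induction step for counting: geodesics to \<open>z\<close> extend by the arc
  \<open>(z, y)\<close>. This arc is new, since no geodesic to \<open>z\<close> enters the vertex
  \<open>y\<close>, which is farther from \<open>x\<close> than \<open>z\<close>.\<close>

lemma geodesic_arcs_step:
  assumes "x \<in> V" "y \<in> V" "(z, y) \<in> E" "d x y = Suc (d x z)"
  shows "insert (z, y) (geodesic_arcs x z) \<subseteq> geodesic_arcs x y"
    and "(w, y) \<notin> geodesic_arcs x z"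
proof -
  have z: "z \<in> V" using assms in_arcsD1 by auto
  have "(u, v) \<in> geodesic_arcs x y" if "(u, v) \<in> geodesic_arcs x z" for u v
  proof -
    have uv: "(u, v) \<in> E" "d x z = Suc (d x u + d v z)" using that by (auto simp: geodesic_arcs_def)
    then have V: "u \<in> V" "v \<in> V" using in_arcsD1 in_arcsD2 by auto
    have "d v y \<le> Suc (d v z)" "d x y \<le> d x v + d v y" "d x v \<le> Suc (d x u)"
      using dist_arc(2)[OF assms(3) V(2)] dist_arc(2)[OF uv(1) assms(1)]
        dist_triangle[OF assms(1) V(2) assms(2)] by auto
    then show ?thesis using uv assms by (simp add: geodesic_arcs_def)
  qed
  then show "insert (z, y) (geodesic_arcs x z) \<subseteq> geodesic_arcs x y"
    using assms by (auto simp: geodesic_arcs_def)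
  show "(w, y) \<notin> geodesic_arcs x z"
  proof
    assume "(w, y) \<in> geodesic_arcs x z"
    then have *: "(w, y) \<in> E" "d x z = Suc (d x w + d y z)" by (auto simp: geodesic_arcs_def)
    moreover have "d x y \<le> Suc (d x w)" using * dist_arc assms by blast
    ultimately show False using assms by simp
  qed
qed

lemma card_geodesic_arcs_ge:
  assumes "x \<in> V" "y \<in> V"
  shows "d x y \<le> card (geodesic_arcs x y)"
  using assms(2)
proof (induction "d x y" arbitrary: y)
  case 0
  then show ?case by simp
next
  case (Suc k)
  then have "x \<noteq> y" using assms by auto
  then obtain z where z: "(z, y) \<in> E" "d x y = Suc (d x z)"
    using dist_predecessor Suc.prems assms by metis
  have "card (insert (z, y) (geodesic_arcs x z)) \<le> card (geodesic_arcs x y)"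
    using geodesic_arcs_step(1)[OF assms(1) Suc.prems z] by (intro card_mono) auto
  then show ?case
    using Suc.hyps(1)[of z] Suc.hyps(2) z in_arcsD1 geodesic_arcs_step(2)[OF assms(1) Suc.prems z] by simp
qed

lemma card_separating_ge:
  assumes "x \<in> V" "y \<in> V"
  shows "d x y \<le> card (separating x y)"
  using card_geodesic_arcs_ge[OF assms] card_mono[OF _ geodesic_arcs_subset_separating[OF assms]]
  by simp

text \<open>The \<open>d x y\<close> or more geodesic arcs towards \<open>y\<close> never enter
  \<open>w\<close>, so the two last arcs \<open>(y, w)\<close> and \<open>(z, w)\<close> both come
  on top. Tightness therefore forces unique predecessors.\<close>

lemma card_separating_gt:
  assumes "x \<in> V" "(y, w) \<in> E" "(z, w) \<in> E" "y \<noteq> z"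
    and "d x w = Suc (d x y)" "d x w = Suc (d x z)"
  shows "d x w < card (separating x w)"
proof -
  have V: "y \<in> V" "w \<in> V" "z \<in> V" using assms in_arcsD1 in_arcsD2 by auto
  have "insert (z, w) (insert (y, w) (geodesic_arcs x y)) \<subseteq> geodesic_arcs x w"
    using geodesic_arcs_step(1)[OF assms(1) V(2)] assms by auto
  then have "card (insert (z, w) (insert (y, w) (geodesic_arcs x y))) \<le> card (separating x w)"
    using geodesic_arcs_subset_separating V assms by (intro card_mono) auto
  then show ?thesis
    using geodesic_arcs_step(2)[OF assms(1) V(2) assms(2)] card_geodesic_arcs_ge[of x y] V assms
    by simp
qed

section \<open>Ascending arcs and the number of edges\<close>

definition ascending :: "'a \<Rightarrow> ('a \<times> 'a) set" where
  "ascending x = {(u, v) \<in> E. d x u < d x v}"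

lemma finite_ascending [simp]: "finite (ascending x)"
  by (rule finite_subset[of _ E]) (auto simp: ascending_def)

text \<open>Every vertex but \<open>x\<close> has a predecessor on a geodesic from \<open>x\<close>.
  So there are at least \<open>card V - 1\<close> ascending arcs, with equality only if predecessors
  are unique; this links edge counts to geodesics.\<close>

lemma snd_ascending:
  assumes "x \<in> V"
  shows "snd ` ascending x = V - {x}"
proof
  show "snd ` ascending x \<subseteq> V - {x}"
    using assms in_arcsD2 by (auto simp: ascending_def)
  show "V - {x} \<subseteq> snd ` ascending x"
  proof
    fix v assume "v \<in> V - {x}"
    then obtain z where "(z, v) \<in> E" "d x v = Suc (d x z)"
      using dist_predecessor assms by (metis DiffE singletonI)
    then show "v \<in> snd ` ascending x" by (force simp: ascending_def)
  qed
qed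

lemma card_arcs_eq: "card E = card (horizontal x) + 2 * card (ascending x)"
proof -
  have "E = horizontal x \<union> (ascending x \<union> (ascending x)\<inverse>)"
    by (auto simp: horizontal_def ascending_def arcs_symmetric)
  moreover have "horizontal x \<inter> (ascending x \<union> (ascending x)\<inverse>) = {}"
    "ascending x \<inter> (ascending x)\<inverse> = {}"
    by (auto simp: horizontal_def ascending_def)
  ultimately show ?thesis
    by (metis card_Un_disjoint card_inverse finite_Un finite_ascending finite_converse finite_horizontal
        mult_2)
qed

end

section \<open>Nonbipartite graphs\<close>

text \<open>The elements \<open>a\<close>, \<open>b\<close>, \<open>c\<close> give 6 ordered pairs
  among themselves. Any other element differs from at least two of them, which gives 4 more ordered
  pairs, hence \<open>6 + 4 * (card A - 3)\<close> in all. In the case of equality the others agree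
  with one of the three and with each other.\<close>

lemma distinct_value_pairs:
  fixes f :: "'a \<Rightarrow> 'b"
  assumes fin: "finite A" and abc: "a \<in> A" "b \<in> A" "c \<in> A"
    and dist: "f a \<noteq> f b" "f a \<noteq> f c" "f b \<noteq> f c"
  defines "q \<equiv> card {(x, y) \<in> A \<times> A. f x \<noteq> f y}"
  shows "4 * card A \<le> q + 6"
    and "q + 6 = 4 * card A \<Longrightarrow> w \<in> A \<Longrightarrow> f w \<in> {f a, f b, f c}"
    and "q + 6 = 4 * card A \<Longrightarrow> w \<in> A - {a, b, c} \<Longrightarrow> w' \<in> A - {a, b, c} \<Longrightarrow> f w = f w'"
proof -
  define D where "D = {a, b, c}"
  define R where "R = A - D"
  let ?g = "\<lambda>x y. if f x \<noteq> f y then 1 else 0 :: nat"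
  have D: "finite D" "D \<subseteq> A" "card D = 3" using abc dist by (auto simp: D_def card_insert_if)
  have R: "finite R" "A = D \<union> R" "D \<inter> R = {}" using fin D by (auto simp: R_def)
  have cardA: "card A = 3 + card R" using R D by (simp add: card_Un_disjoint)
  have "q = (\<Sum>(x, y)\<in>A \<times> A. ?g x y)"
  proof -
    have "{p \<in> A \<times> A. f (fst p) \<noteq> f (snd p)} = {(x, y) \<in> A \<times> A. f x \<noteq> f y}" by auto
    then show ?thesis
      unfolding q_def using fin by (simp add: case_prod_unfold sum.If_cases Int_def)
  qed
  also have "\<dots> = (\<Sum>x\<in>A. \<Sum>y\<in>A. ?g x y)" by (simp only: sum.cartesian_product)
  also have "\<dots> = (\<Sum>x\<in>D. \<Sum>y\<in>D. ?g x y) + (\<Sum>x\<in>D. \<Sum>y\<in>R. ?g x y) +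
      ((\<Sum>x\<in>R. \<Sum>y\<in>D. ?g x y) + (\<Sum>x\<in>R. \<Sum>y\<in>R. ?g x y))"
  proof -
    have "sum h A = sum h D + sum h R" for h :: "'a \<Rightarrow> nat"
      using R D(1) by (simp add: sum.union_disjoint)
    then show ?thesis by (simp only: sum.distrib)
  qed
  also have "(\<Sum>x\<in>D. \<Sum>y\<in>R. ?g x y) = (\<Sum>x\<in>R. \<Sum>y\<in>D. ?g x y)"
    by (subst sum.swap) (intro sum.cong refl, auto)
  also have "(\<Sum>x\<in>D. \<Sum>y\<in>D. ?g x y) = 6"
  proof -
    have "a \<noteq> b" "a \<noteq> c" "b \<noteq> c" using dist by auto
    then show ?thesis using dist dist[symmetric] by (simp add: D_def)
  qed
  finally have q: "q = 6 + 2 * (\<Sum>x\<in>R. \<Sum>y\<in>D. ?g x y) + (\<Sum>x\<in>R. \<Sum>y\<in>R. ?g x y)" by simp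
  have g2: "2 \<le> (\<Sum>y\<in>D. ?g x y)" "(\<Sum>y\<in>D. ?g x y) = 2 \<Longrightarrow> f x \<in> {f a, f b, f c}" for x
  proof -
    have "a \<noteq> b" "a \<noteq> c" "b \<noteq> c" using dist by auto
    then have "(\<Sum>y\<in>D. ?g x y) = ?g x a + (?g x b + ?g x c)" by (simp add: D_def)
    then show "2 \<le> (\<Sum>y\<in>D. ?g x y)" "(\<Sum>y\<in>D. ?g x y) = 2 \<Longrightarrow> f x \<in> {f a, f b, f c}"
      using dist by (auto split: if_splits)
  qed
  have t: "2 * card R \<le> (\<Sum>x\<in>R. \<Sum>y\<in>D. ?g x y)"
    using sum_mono[of R "\<lambda>_. 2" "\<lambda>x. \<Sum>y\<in>D. ?g x y"] g2(1) by simp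
  show "4 * card A \<le> q + 6" using q t cardA by linarith
  assume "q + 6 = 4 * card A"
  then have eq: "(\<Sum>x\<in>R. \<Sum>y\<in>D. ?g x y) = (\<Sum>x\<in>R. 2)" "(\<Sum>x\<in>R. \<Sum>y\<in>R. ?g x y) = 0"
    using q t cardA by auto
  show "f w \<in> {f a, f b, f c}" if "w \<in> A"
  proof (cases "w \<in> D")
    case False
    then have "w \<in> R" using that by (simp add: R_def)
    then have "(\<Sum>y\<in>D. ?g w y) = 2"
      using sum_mono_inv[OF eq(1)[symmetric] _ _ R(1)] g2(1) by metis
    then show ?thesis by (rule g2(2))
  qed (auto simp: D_def)
  show "f w = f w'" if "w \<in> A - {a, b, c}" "w' \<in> A - {a, b, c}"
  proof -
    have "\<forall>x\<in>R. \<forall>y\<in>R. ?g x y = 0" using eq(2) R(1) by simp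
    then have "?g w w' = 0" using that unfolding R_def D_def by blast
    then show ?thesis by (metis one_neq_zero)
  qed
qed

locale nonbipartite_connected_graph = connected_pair_graph +
  assumes nonbipartite: "\<not> bipartite_graph G"
begin

text \<open>Without horizontal arcs the parity of the distance from \<open>x\<close> would be a
  bipartition.\<close>

lemma horizontal_nonempty:
  assumes "x \<in> V"
  shows "horizontal x \<noteq> {}"
proof
  assume empty: "horizontal x = {}"
  have "even (d x u) \<noteq> even (d x v)" if "(u, v) \<in> E" for u v
  proof -
    have "d x u \<noteq> d x v" using that empty by (auto simp: horizontal_def)
    then have "d x u = Suc (d x v) \<or> d x v = Suc (d x u)"
      using dist_arc[OF that assms] by linarith
    then show ?thesis by auto
  qed
  then have "bipartite_graph G"
    unfolding bipartite_graph_def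
    using in_arcsD1 in_arcsD2
    by (intro exI[of _ "{v \<in> V. even (d x v)}"] exI[of _ "{v \<in> V. odd (d x v)}"]) blast
  then show False using nonbipartite by blast
qed

text \<open>Take \<open>uv\<close> horizontal to \<open>x\<close> at the least possible distance,
  and let \<open>q\<close> and \<open>p\<close> precede \<open>x\<close> on geodesics from
  \<open>v\<close> and from \<open>u\<close>. The arc \<open>uv\<close> tells \<open>x\<close> apart
  from \<open>u\<close> and \<open>v\<close>, and \<open>xq\<close> tells \<open>u\<close> apart
  from \<open>v\<close>.\<close>

lemma three_distinct_horizontal:
  obtains x u v p q where "x \<in> V" "(u, v) \<in> horizontal x" "(x, p) \<in> horizontal v"
    "(x, q) \<in> horizontal u" "d u x = Suc (d u p)" "d v x = Suc (d v q)"
    "horizontal x \<noteq> horizontal u" "horizontal x \<noteq> horizontal v" "horizontal u \<noteq> horizontal v"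
    "\<And>y s t. y \<in> V \<Longrightarrow> (s, t) \<in> horizontal y \<Longrightarrow> d x u \<le> d y s"
proof -
  define P where "P k \<longleftrightarrow> (\<exists>y s t. y \<in> V \<and> (s, t) \<in> horizontal y \<and> d y s = k)" for k
  obtain x0 where "x0 \<in> V" using conn by (auto simp: connected_conv)
  then have "\<exists>k. P k" using horizontal_nonempty[of x0] unfolding P_def by fast
  then have least: "P (LEAST k. P k)" "\<And>k. P k \<Longrightarrow> (LEAST k. P k) \<le> k"
    by (auto intro: LeastI_ex Least_le)
  then obtain x u v where x: "x \<in> V" and uv: "(u, v) \<in> horizontal x" "d x u = (LEAST k. P k)"
    unfolding P_def by blast
  have minimal: "d x u \<le> d y s" if "y \<in> V" "(s, t) \<in> horizontal y" for y s t
    using that least(2) uv(2) unfolding P_def by auto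
  have E: "(u, v) \<in> E" "d x u = d x v" using uv by (auto simp: horizontal_def)
  then have V: "u \<in> V" "v \<in> V" "u \<noteq> v" using in_arcsD1 in_arcsD2 no_loops' by auto
  text \<open>If \<open>xq\<close> were not horizontal to \<open>u\<close>, then \<open>uv\<close> would be horizontal to \<open>q\<close> and closer to it than to \<open>x\<close>.\<close>
  have step: "\<exists>q. (x, q) \<in> horizontal u \<and> d v x = Suc (d v q)"
    if uv: "(u, v) \<in> horizontal x" and min: "d x u = (LEAST k. P k)" for u v
  proof -
    have E: "(u, v) \<in> E" "d x u = d x v" using uv by (auto simp: horizontal_def)
    then have V: "u \<in> V" "v \<in> V" "u \<noteq> v" using in_arcsD1 in_arcsD2 no_loops' by auto
    have "x \<noteq> v" using E V x by (metis dist_eq_0_iff)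
    then obtain q where q: "(q, x) \<in> E" "d v x = Suc (d v q)"
      using dist_predecessor V x by metis
    have qV: "q \<in> V" using q in_arcsD1 by auto
    have sym: "d q u = d u q" "d q v = d v q" "d x u = d u x" "d x v = d v x"
      using dist_sym V qV x by auto
    have "d q u \<le> Suc (d q v)" using dist_arc(1)[OF E(1) qV] .
    moreover have "d u x \<le> Suc (d u q)" using dist_arc[OF q(1) V(1)] by simp
    moreover have "d q u \<noteq> d q v"
    proof
      assume "d q u = d q v"
      then have "P (d q u)" using qV E unfolding P_def by (auto simp: horizontal_def)
      then have "d x u \<le> d q u" using least(2) min by simp
      then show False using \<open>d q u = d q v\<close> q sym E by simp
    qed
    \<comment> \<open>The value \<open>d u q\<close> lies between \<open>d v q\<close> and
      \<open>d v q + 1\<close>, and the lower one was just excluded; the upper one is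
      \<open>d v x = d u x\<close>.\<close>
    ultimately have "d u x = d u q" using sym E q by linarith
    then show ?thesis using q arcs_symmetric by (auto simp: horizontal_def)
  qed
  obtain q where q: "(x, q) \<in> horizontal u" "d v x = Suc (d v q)"
    using step uv by blast
  have "(v, u) \<in> horizontal x" "d x v = (LEAST k. P k)" using uv E horizontal_swap by auto
  then obtain p where p: "(x, p) \<in> horizontal v" "d u x = Suc (d u p)"
    using step by blast
  have "(u, v) \<notin> horizontal u" "(u, v) \<notin> horizontal v"
    using V dist_eq_0_iff by (auto simp: horizontal_def)
  moreover have "(x, q) \<notin> horizontal v" using q by (auto simp: horizontal_def)
  ultimately show ?thesis using that[OF x uv(1) p(1) q(1) p(2) q(2)] minimal uv q by metis
qed

lemma pair_term_ge:
  assumes "x \<in> V" "y \<in> V"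
  shows "2 + 2 * of_bool (horizontal x \<noteq> horizontal y) \<le> card (horizontal x \<union> horizontal y)"
proof -
  have "card (horizontal x) \<le> card (horizontal x \<union> horizontal y)" by (intro card_mono) auto
  then show ?thesis
    using card_horizontal_ge[of x] card_horizontal_Un_ge[of x y] horizontal_nonempty assms by auto
qed

definition distinct_pairs :: "('a \<times> 'a) set" where
  "distinct_pairs = {(x, y) \<in> V \<times> V. horizontal x \<noteq> horizontal y}"

lemma sum_distinct_pairs:
  "(\<Sum>(x, y)\<in>V \<times> V. 1 / 2 + of_bool (horizontal x \<noteq> horizontal y) / 2) =
    ((real (card V))\<^sup>2 + real (card distinct_pairs)) / 2"
proof -
  have "(\<Sum>(x, y)\<in>V \<times> V. of_bool (horizontal x \<noteq> horizontal y) :: real) = real (card distinct_pairs)"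
  proof -
    have "{p \<in> V \<times> V. horizontal (fst p) \<noteq> horizontal (snd p)} = distinct_pairs"
      by (auto simp: distinct_pairs_def)
    then show ?thesis by (simp add: case_prod_unfold of_bool_def sum.If_cases Int_def)
  qed
  then show ?thesis
    by (simp add: case_prod_unfold sum.distrib sum_divide_distrib[symmetric] card_cartesian_product
        power2_eq_square add_divide_distrib)
qed

lemma distinct_pairs_ge: "4 * card V \<le> card distinct_pairs + 6"
proof -
  obtain x u v where "x \<in> V" "(u, v) \<in> horizontal x"
    and "horizontal x \<noteq> horizontal u" "horizontal x \<noteq> horizontal v" "horizontal u \<noteq> horizontal v"
    by (rule three_distinct_horizontal)
  moreover from this have "u \<in> V" "v \<in> V" using in_arcsD1 in_arcsD2 by (auto simp: horizontal_def)
  ultimately show ?thesis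
    unfolding distinct_pairs_def by (intro distinct_value_pairs(1)[OF finite_verts])
qed

text \<open>Two estimates are chained: each pair contributes at least \<open>?lower\<close>, and
  there are at least \<open>4 * card V - 6\<close> distinct pairs. Equality in the chain means
  equality in both, and in the first one this means equality for every pair.\<close>

lemma difference_ge:
  "((real (card V))\<^sup>2 + 4 * real (card V) - 6) / 4 \<le> revised_szeged_index G - wiener_index G"
  and difference_eq_iff:
  "revised_szeged_index G - wiener_index G = ((real (card V))\<^sup>2 + 4 * real (card V) - 6) / 4 \<longleftrightarrow>
    card distinct_pairs + 6 = 4 * card V \<and>
    (\<forall>x\<in>V. \<forall>y\<in>V. card (separating x y) = d x y \<and>
      card (horizontal x \<union> horizontal y) = 2 + 2 * of_bool (horizontal x \<noteq> horizontal y))"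
    (is "?eq \<longleftrightarrow> ?tight")
proof -
  \<comment> \<open>A quarter of the bound in \<open>pair_term_ge\<close>: 1/2 for equal horizontal
    sets, and 1 for different ones.\<close>
  let ?lower = "\<lambda>(x, y). 1 / 2 + of_bool (horizontal x \<noteq> horizontal y) / 2 :: real"
  let ?term = "\<lambda>(x, y). real (card (separating x y)) - real (d x y)
    + real (card (horizontal x \<union> horizontal y)) / 4"
  have le: "?lower p \<le> ?term p" if pV: "p \<in> V \<times> V" for p
  proof -
    obtain x y where p: "p = (x, y)" "x \<in> V" "y \<in> V" using pV by auto
    show ?thesis
      using pair_term_ge[OF p(2,3)] card_separating_ge[OF p(2,3)] unfolding p(1)
      by (cases "horizontal x = horizontal y") simp_all
  qed
  have lower: "sum ?lower (V \<times> V) = ((real (card V))\<^sup>2 + real (card distinct_pairs)) / 2"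
    by (rule sum_distinct_pairs)
  have diff: "revised_szeged_index G - wiener_index G = sum ?term (V \<times> V) / 2"
    using difference_eq by simp
  have mono: "sum ?lower (V \<times> V) \<le> sum ?term (V \<times> V)" using le by (rule sum_mono)
  have pairs: "4 * real (card V) \<le> real (card distinct_pairs) + 6" using distinct_pairs_ge by linarith
  show "((real (card V))\<^sup>2 + 4 * real (card V) - 6) / 4 \<le> revised_szeged_index G - wiener_index G"
    using mono pairs unfolding lower diff by (simp add: field_simps)
  have "?eq \<longleftrightarrow> real (card distinct_pairs) + 6 = 4 * real (card V) \<and> sum ?term (V \<times> V) = sum ?lower (V \<times> V)"
    using mono pairs unfolding lower diff by (auto simp: field_simps)
  also have "sum ?term (V \<times> V) = sum ?lower (V \<times> V) \<longleftrightarrow> (\<forall>p\<in>V \<times> V. ?term p = ?lower p)"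
  proof
    assume eq: "sum ?term (V \<times> V) = sum ?lower (V \<times> V)"
    show "\<forall>p\<in>V \<times> V. ?term p = ?lower p"
    proof
      fix p assume p: "p \<in> V \<times> V"
      have "finite (V \<times> V)" by simp
      with eq[symmetric] le p show "?term p = ?lower p" by (rule sum_mono_inv[symmetric])
    qed
  next
    assume "\<forall>p\<in>V \<times> V. ?term p = ?lower p"
    then show "sum ?term (V \<times> V) = sum ?lower (V \<times> V)" by (intro sum.cong) blast+
  qed
  also have "\<dots> \<longleftrightarrow> (\<forall>x\<in>V. \<forall>y\<in>V. card (separating x y) = d x y \<and>
      card (horizontal x \<union> horizontal y) = 2 + 2 * of_bool (horizontal x \<noteq> horizontal y))"
  proof -
    have "?term (x, y) = ?lower (x, y) \<longleftrightarrow> card (separating x y) = d x y \<and>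
      card (horizontal x \<union> horizontal y) = 2 + 2 * of_bool (horizontal x \<noteq> horizontal y)"
      if "x \<in> V" "y \<in> V" for x y
    proof -
      \<comment> \<open>Both slacks \<open>s - t\<close> and \<open>c / 4 - e\<close> are
        nonnegative, so their sum vanishes only if each of them does.\<close>
      have *: "s - t + c / 4 = e \<longleftrightarrow> s = t \<and> c = 4 * e" if "t \<le> s" "4 * e \<le> c" for s t c e :: real
        using that by auto
      define k :: nat where "k = 2 + 2 * of_bool (horizontal x \<noteq> horizontal y)"
      have "1 / 2 + of_bool (horizontal x \<noteq> horizontal y) / 2 = real k / 4"
        by (simp add: k_def)
      moreover have "k \<le> card (horizontal x \<union> horizontal y)"
        using pair_term_ge[OF that] by (simp only: k_def)
      moreover note card_separating_ge[OF that]
      ultimately show ?thesis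
        unfolding k_def[symmetric] by (simp add: *)
    qed
    then show ?thesis by (simp only: split_paired_Ball_Sigma) blast
  qed
  also have "real (card distinct_pairs) + 6 = 4 * real (card V) \<longleftrightarrow> card distinct_pairs + 6 = 4 * card V"
    by linarith
  finally show "?eq \<longleftrightarrow> ?tight" .
qed

end


section \<open>The extremal graphs\<close>

text \<open>This lets the connectedness of the tree be derived from plain reachability along its
  arcs.\<close>

lemma connected_iff_rtrancl:
  assumes "pair_graph H"
  shows "Digraph_Component.connected (with_proj H) \<longleftrightarrow>
    pverts H \<noteq> {} \<and> (\<forall>u\<in>pverts H. \<forall>v\<in>pverts H. (u, v) \<in> (parcs H)\<^sup>*)"
proof
  assume conn: "Digraph_Component.connected (with_proj H)"
  then have "connected_pair_graph H"
    using assms by (simp add: connected_pair_graph_def connected_pair_graph_axioms_def)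
  then show "pverts H \<noteq> {} \<and> (\<forall>u\<in>pverts H. \<forall>v\<in>pverts H. (u, v) \<in> (parcs H)\<^sup>*)"
    using conn connected_pair_graph.reachable_in_graph[of H] by (simp add: connected_conv)
next
  interpret pair_graph H by fact
  assume *: "pverts H \<noteq> {} \<and> (\<forall>u\<in>pverts H. \<forall>v\<in>pverts H. (u, v) \<in> (parcs H)\<^sup>*)"
  have "(u, v) \<in> rtrancl_on (pverts H) ((parcs H)\<^sup>s)" if "u \<in> pverts H" "(u, v) \<in> (parcs H)\<^sup>*" for u v
    using that(2)
  proof (induction rule: rtrancl_induct)
    case base
    then show ?case using that(1) by (rule rtrancl_on_refl)
  next
    case (step y z)
    then show ?case
      using in_arcsD2 by (auto simp: symcl_def intro: rtrancl_on_into_rtrancl_on)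
  qed
  then show "Digraph_Component.connected (with_proj H)"
    using * by (auto simp: connected_conv)
qed

section \<open>Undirected cycles in terms of arcs\<close>

lemma pcas_nth:
  assumes "pcas u p v"
  shows "Suc i < length p \<Longrightarrow> fst (p ! Suc i) = snd (p ! i)"
    and "p \<noteq> [] \<Longrightarrow> fst (p ! 0) = u"
    and "p \<noteq> [] \<Longrightarrow> snd (last p) = v"
proof -
  show "Suc i < length p \<Longrightarrow> fst (p ! Suc i) = snd (p ! i)"
    using assms
  proof (induction p arbitrary: u i)
    case (Cons e p)
    then show ?case by (cases i; cases p) auto
  qed simp
  show "p \<noteq> [] \<Longrightarrow> fst (p ! 0) = u" using assms by (cases p) auto
  show "p \<noteq> [] \<Longrightarrow> snd (last p) = v"
    using assms by (induction p arbitrary: u) auto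
qed

lemma pawalk_verts_eq: "pcas u p v \<Longrightarrow> pawalk_verts u p = u # map snd p"
proof (induction p arbitrary: u)
  case (Cons e p)
  then show ?case by (cases p) auto
qed simp

text \<open>With positions read modulo the length, take the arcs before and after
  \<open>(y, w)\<close>. Their positions differ because the length is at least 3, and the heads of
  the arcs of a cycle are distinct, so \<open>z\<close> is not \<open>y\<close>. Thus the cycle has
  two different neighbours at \<open>w\<close>.\<close>

lemma undirected_cycle_turn:
  assumes "pair_graph H" "undirected_cycle H p" "(y, w) \<in> set p"
  shows "\<exists>x z. z \<noteq> y \<and> (x, y) \<in> set p \<and> (w, z) \<in> set p"
proof -
  interpret pair_graph H by fact
  obtain u where u: "awalk u p u" "distinct (tl (awalk_verts u p))" "3 \<le> length p"
    using assms(2) by (auto simp: undirected_cycle_def cycle_def)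
  have cas: "pcas u p u" using u(1) by (auto simp: awalk_def)
  have dist: "distinct (map snd p)" using u(2) pawalk_verts_eq[OF cas] by simp
  let ?n = "length p"
  have nz: "p \<noteq> []" using u by auto
  have next_arc: "fst (p ! (Suc i mod ?n)) = snd (p ! i)" if "i < ?n" for i
  proof (cases "Suc i < ?n")
    case True
    then show ?thesis using pcas_nth(1)[OF cas] by simp
  next
    case False
    then have "Suc i = ?n" using that by simp
    then show ?thesis
      using pcas_nth(2,3)[OF cas nz] last_conv_nth[OF nz] by (metis diff_Suc_1 mod_self)
  qed
  obtain i where i: "i < ?n" "p ! i = (y, w)" using assms(3) by (auto simp: in_set_conv_nth)
  define j where "j = Suc i mod ?n"
  define k where "k = (i + ?n - 1) mod ?n"
  have jk: "j < ?n" "k < ?n" using nz by (auto simp: j_def k_def)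
  have "Suc k mod ?n = i"
    using i nz by (simp add: k_def mod_Suc_eq)
  then have k: "snd (p ! k) = y" using next_arc[OF jk(2)] i by simp
  have j: "fst (p ! j) = w" using next_arc[OF i(1)] i by (simp add: j_def)
  have "j \<noteq> k"
  proof -
    have "j = (if Suc i = ?n then 0 else Suc i)" using i by (simp add: j_def)
    moreover have "k = (if i = 0 then ?n - 1 else i - 1)"
      using i u(3) by (cases i) (auto simp: k_def)
    ultimately show ?thesis using i u(3) by (auto split: if_splits)
  qed
  then have "snd (p ! j) \<noteq> snd (p ! k)"
    using dist jk by (simp add: distinct_conv_nth)
  then have "snd (p ! j) \<noteq> y" using k by simp
  moreover have "(w, snd (p ! j)) \<in> set p" "(fst (p ! k), y) \<in> set p"
    using jk j k nth_mem by (metis prod.collapse)+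
  ultimately show ?thesis by blast
qed

text \<open>A walk from \<open>v\<close> to \<open>u\<close> off the edge \<open>uv\<close> shortens
  to a path off that edge, which \<open>(u, v)\<close> closes. The path has at least two arcs: none
  would mean \<open>u = v\<close>, and a single one would be the excluded
  \<open>(v, u)\<close>.\<close>

lemma undirected_cycle_if_reachable:
  assumes "pair_graph H" "(u, v) \<in> parcs H"
    and "(v, u) \<in> (parcs H - {(u, v), (v, u)})\<^sup>*"
  shows "\<exists>p. undirected_cycle H p"
proof -
  interpret pair_graph H by fact
  let ?F = "parcs H - {(u, v), (v, u)}"
  have v: "v \<in> pverts H" and neq: "u \<noteq> v" using assms(2) in_arcsD2 no_loops' by auto
  have "\<exists>p. awalk v p w \<and> set p \<subseteq> ?F" if "(v, w) \<in> ?F\<^sup>*" for w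
    using that
  proof (induction rule: rtrancl_induct)
    case base
    have "awalk v [] v" using v by (simp add: awalk_Nil_iff)
    then show ?case by (intro exI[of _ "[]"]) simp
  next
    case (step y z)
    then obtain p where p: "awalk v p y" "set p \<subseteq> ?F" by blast
    have "awalk y [(y, z)] z" using step in_arcsD1 by (simp add: awalk_def) blast
    then have "awalk v (p @ [(y, z)]) z" using p(1) by (simp only: awalk_appendI)
    then show ?case using p(2) step(2) by (intro exI[of _ "p @ [(y, z)]"]) simp
  qed
  then obtain p where p: "awalk v p u" "set p \<subseteq> ?F" using assms(3) by blast
  define q where "q = awalk_to_apath p"
  have q: "apath v q u" "set q \<subseteq> ?F"
    using apath_awalk_to_apath[OF p(1)] awalk_to_apath_subset[OF p(1)] p(2) by (auto simp: q_def)
  then have walk: "awalk v q u" "distinct (pawalk_verts v q)" by (auto simp: apath_def)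
  then have "awalk u ((u, v) # q) u" using assms(2) by (simp add: awalk_Cons_iff)
  moreover have "distinct (tl (awalk_verts u ((u, v) # q)))" using walk by simp
  moreover have "2 \<le> length q"
  proof (rule ccontr)
    assume "\<not> 2 \<le> length q"
    then consider "q = []" | e where "q = [e]"
      by (metis One_nat_def Suc_1 length_0_conv length_Suc_conv less_Suc_eq not_le less_one)
    then show False
      using walk(1) q(2) neq by cases (auto simp: awalk_def)
  qed
  ultimately have "cycle ((u, v) # q)" "3 \<le> length ((u, v) # q)"
    unfolding cycle_def by (blast, simp)
  then show ?thesis unfolding undirected_cycle_def by blast
qed

text \<open>Written as a directed triangle together with its converse, the shape of the arc set in
  \<open>cycle_graph\<close>.\<close>

definition triangle_arcs :: "'a \<Rightarrow> 'a \<Rightarrow> 'a \<Rightarrow> ('a \<times> 'a) set" where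
  "triangle_arcs a b c = {(a, b), (b, c), (c, a)} \<union> {(b, a), (c, b), (a, c)}"

lemma cycle_graph_3_iff:
  "cycle_graph 3 C \<longleftrightarrow>
    (\<exists>a b c. a \<noteq> b \<and> b \<noteq> c \<and> a \<noteq> c \<and> pverts C = {a, b, c} \<and> parcs C = triangle_arcs a b c)"
proof
  assume C: "cycle_graph 3 C"
  then interpret pair_graph C by (simp add: cycle_graph_def)
  obtain p where p: "cycle p" "length p = 3" "pverts C = fst ` set p" "parcs C = set p \<union> (set p)\<inverse>"
    using C by (auto simp: cycle_graph_def undirected_cycle_def)
  then obtain u where u: "awalk u p u" "distinct (tl (awalk_verts u p))" by (auto simp: cycle_def)
  have cas: "pcas u p u" using u by (auto simp: awalk_def)
  obtain e1 e2 e3 where e: "p = [e1, e2, e3]"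
    using p(2) by (auto simp: numeral_3_eq_3 length_Suc_conv)
  then have p': "p = [(u, fst e2), (fst e2, fst e3), (fst e3, u)]"
    using cas by (cases e1; cases e2; cases e3) auto
  define b c where "b = fst e2" and "c = fst e3"
  have p'': "p = [(u, b), (b, c), (c, u)]" using p' by (simp add: b_def c_def)
  have "u \<noteq> b \<and> b \<noteq> c \<and> u \<noteq> c"
    using u(2) pawalk_verts_eq[OF cas] unfolding p'' by auto
  moreover have "pverts C = {u, b, c}" "parcs C = triangle_arcs u b c"
    using p(3,4) unfolding p'' triangle_arcs_def by auto
  ultimately show "\<exists>a b c. a \<noteq> b \<and> b \<noteq> c \<and> a \<noteq> c \<and> pverts C = {a, b, c} \<and> parcs C = triangle_arcs a b c"
    by blast
next
  assume "\<exists>a b c. a \<noteq> b \<and> b \<noteq> c \<and> a \<noteq> c \<and> pverts C = {a, b, c} \<and> parcs C = triangle_arcs a b c"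
  then obtain a b c where abc: "a \<noteq> b" "b \<noteq> c" "a \<noteq> c"
    and C: "pverts C = {a, b, c}" "parcs C = triangle_arcs a b c" by blast
  have "sym (parcs C)" by (rule symI) (auto simp: C triangle_arcs_def)
  interpret pair_graph C
  proof unfold_locales
    show "fst e \<in> pverts C" "snd e \<in> pverts C" "fst e \<noteq> snd e" if "e \<in> parcs C" for e
      using that abc unfolding C triangle_arcs_def by auto
    show "finite (pverts C)" "finite (parcs C)" unfolding C triangle_arcs_def by simp_all
    show "symmetric (with_proj C)" using \<open>sym (parcs C)\<close> by (simp add: symmetric_def)
  qed
  let ?p = "[(a, b), (b, c), (c, a)]"
  have "awalk a ?p a" using C by (auto simp: awalk_def triangle_arcs_def)
  moreover have "distinct (tl (awalk_verts a ?p))" using abc by auto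
  ultimately have "cycle ?p" unfolding cycle_def by blast
  then have "undirected_cycle C ?p" by (simp add: undirected_cycle_def)
  then show "cycle_graph 3 C"
    unfolding cycle_graph_def using C pair_graph
    by (intro conjI exI[of _ ?p]) (auto simp: triangle_arcs_def)
qed

section \<open>The triangle in an extremal graph\<close>

context nonbipartite_connected_graph
begin

lemma extremal_triangle:
  assumes n: "4 \<le> card V"
    and pairs: "card distinct_pairs + 6 = 4 * card V"
    and card2: "\<And>x. x \<in> V \<Longrightarrow> card (horizontal x) = 2"
  obtains a b c where "a \<in> V" "b \<in> V" "c \<in> V" "a \<noteq> b" "b \<noteq> c" "a \<noteq> c"
    "horizontal a = {(b, c), (c, b)}" "horizontal b = {(a, c), (c, a)}"
    "\<And>w. w \<in> V - {a, b} \<Longrightarrow> horizontal w = {(a, b), (b, a)}"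
proof -
  obtain x u v p q where x: "x \<in> V" and uv: "(u, v) \<in> horizontal x"
    and p: "(x, p) \<in> horizontal v" "d u x = Suc (d u p)"
    and q: "(x, q) \<in> horizontal u" "d v x = Suc (d v q)"
    and ne: "horizontal x \<noteq> horizontal u" "horizontal x \<noteq> horizontal v" "horizontal u \<noteq> horizontal v"
    and minimal: "\<And>y s t. y \<in> V \<Longrightarrow> (s, t) \<in> horizontal y \<Longrightarrow> d x u \<le> d y s"
    by (rule three_distinct_horizontal) blast
  have E: "(u, v) \<in> E" "(x, p) \<in> E" "(x, q) \<in> E" "d x u = d x v"
    using uv p q by (auto simp: horizontal_def)
  then have V: "u \<in> V" "v \<in> V" "p \<in> V" "q \<in> V" using in_arcsD1 in_arcsD2 by auto
  have sym: "d x u = d u x" "d x v = d v x" using dist_sym x V by auto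
  have two: "horizontal y = {(s, t), (t, s)}" if y: "y \<in> V" and st: "(s, t) \<in> horizontal y" for y s t
  proof -
    have "s \<noteq> t" using st no_loops' by (auto simp: horizontal_def)
    moreover have "{(s, t), (t, s)} \<subseteq> horizontal y" using st horizontal_swap by blast
    ultimately show ?thesis using card2[OF y] card_subset_eq[of "horizontal y" "{(s, t), (t, s)}"] by simp
  qed
  note in_three = distinct_value_pairs(2)[OF finite_verts x V(1,2) ne, folded distinct_pairs_def, OF pairs]
  note rest_eq = distinct_value_pairs(3)[OF finite_verts x V(1,2) ne, folded distinct_pairs_def, OF pairs]
  \<comment> \<open>Otherwise \<open>q\<close> shares the horizontal edge of \<open>x\<close>,
    \<open>u\<close> or \<open>v\<close>. It is not \<open>uv\<close>, by minimality, since
    \<open>q\<close> is closer to \<open>v\<close> than \<open>x\<close> is; nor \<open>xq\<close>,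
    which ends in \<open>q\<close>. So it is \<open>xp\<close>, at distance 1 from \<open>q\<close>,
    and minimality gives \<open>d x u <= 1\<close>, which forces \<open>d v q = 0\<close>.\<close>
  have "q = v"
  proof (rule ccontr)
    assume "q \<noteq> v"
    have dq: "d q x = 1" "d q q = 0" using E V x dist_eq_1_iff arcs_symmetric by auto
    have "(u, v) \<notin> horizontal q"
      using minimal[OF V(4)] q sym E dist_sym[of v q] V by (fastforce simp: horizontal_def)
    moreover have "(x, q) \<notin> horizontal q" using dq by (simp add: horizontal_def)
    ultimately have "horizontal q = horizontal v"
      using in_three[OF V(4)] uv q by auto
    then have "d x u \<le> d q x" using minimal[OF V(4)] p by blast
    then have "d v q = 0" using dq q sym E by simp
    then show False using \<open>q \<noteq> v\<close> V by simp
  qed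
  then have "d v x = 1" using q V by simp
  then have "d u p = 0" using p sym E by simp
  then have "p = u" using V by simp
  have Hx: "horizontal x = {(u, v), (v, u)}" using two x uv by blast
  have Hu: "horizontal u = {(x, v), (v, x)}" using two V q \<open>q = v\<close> by blast
  have Hv: "horizontal v = {(x, u), (u, x)}" using two V p \<open>p = u\<close> by blast
  have neq: "x \<noteq> u" "x \<noteq> v" "u \<noteq> v" using ne by auto
  have "card {x, u, v} < card V" using neq n by simp
  then have "\<not> V \<subseteq> {x, u, v}" using card_mono[of "{x, u, v}" V] by auto
  then obtain w where w: "w \<in> V - {x, u, v}" by blast
  have rest: "horizontal y = horizontal w" if "y \<in> V - {x, u, v}" for y
    using rest_eq[OF that w] .
  \<comment> \<open>The vertices outside the triangle share one horizontal edge. The vertex of the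
    triangle that also has it becomes \<open>c\<close>.\<close>
  consider "horizontal w = horizontal x" | "horizontal w = horizontal u" | "horizontal w = horizontal v"
    using in_three[of w] w by blast
  then show ?thesis
  proof cases
    case 1
    then have "horizontal y = {(u, v), (v, u)}" if "y \<in> V - {u, v}" for y
      using rest[of y] that Hx by (cases "y = x") auto
    then show ?thesis using that[of u v x] neq x V Hu Hv by (auto simp: insert_commute)
  next
    case 2
    then have "horizontal y = {(x, v), (v, x)}" if "y \<in> V - {x, v}" for y
      using rest[of y] that Hu by (cases "y = u") auto
    then show ?thesis using that[of x v u] neq x V Hx Hv by (auto simp: insert_commute)
  next
    case 3
    then have "horizontal y = {(x, u), (u, x)}" if "y \<in> V - {x, u}" for y
      using rest[of y] that Hv by (cases "y = v") auto
    then show ?thesis using that[of x u v] neq x V Hx Hu by (auto simp: insert_commute)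
  qed
qed

end

section \<open>A triangle attached at one vertex, and the remainder of the graph\<close>

context connected_pair_graph
begin

text \<open>The neighbours of \<open>c\<close> are left free: the triangle meets the rest of the
  graph only there.\<close>

definition pendant_triangle :: "'a \<Rightarrow> 'a \<Rightarrow> 'a \<Rightarrow> bool" where
  "pendant_triangle a b c \<longleftrightarrow> a \<noteq> b \<and> b \<noteq> c \<and> a \<noteq> c \<and> triangle_arcs a b c \<subseteq> E \<and>
    (\<forall>w. (a, w) \<in> E \<longrightarrow> w \<in> {b, c}) \<and> (\<forall>w. (b, w) \<in> E \<longrightarrow> w \<in> {a, c})"

lemma pendant_triangle_commute: "pendant_triangle a b c \<Longrightarrow> pendant_triangle b a c"
  by (auto simp: pendant_triangle_def triangle_arcs_def)

context
  fixes a b c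
  assumes pendant: "pendant_triangle a b c"
begin

lemma pendant_verts: "a \<in> V" "b \<in> V" "c \<in> V" "a \<noteq> b" "b \<noteq> c" "a \<noteq> c"
  using pendant in_arcsD1 by (auto simp: pendant_triangle_def triangle_arcs_def)

lemma pendant_arcs: "(a, b) \<in> E" "(b, a) \<in> E" "(a, c) \<in> E" "(c, a) \<in> E" "(b, c) \<in> E" "(c, b) \<in> E"
  using pendant by (auto simp: pendant_triangle_def triangle_arcs_def)

lemma pendant_neighbours:
  "(a, w) \<in> E \<Longrightarrow> w = b \<or> w = c" "(b, w) \<in> E \<Longrightarrow> w = a \<or> w = c"
  "(w, a) \<in> E \<Longrightarrow> w = b \<or> w = c" "(w, b) \<in> E \<Longrightarrow> w = a \<or> w = c"
  using pendant arcs_symmetric by (auto simp: pendant_triangle_def)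

lemma pendant_dist1: "d a b = 1" "d b a = 1" "d a c = 1" "d c a = 1" "d b c = 1" "d c b = 1"
  using dist_eq_1_iff pendant_arcs pendant_verts by blast+

text \<open>A geodesic enters \<open>a\<close> from \<open>c\<close> or from \<open>b\<close>. In
  the second case \<open>b\<close> is entered from \<open>c\<close>, as \<open>a\<close> and
  \<open>b\<close> cannot precede each other; then \<open>a\<close> is two steps beyond
  \<open>c\<close>, against the arc between them.\<close>

lemma pendant_dist:
  assumes w: "w \<in> V" "w \<noteq> a" "w \<noteq> b"
  shows "d w a = Suc (d w c)"
proof -
  obtain z where z: "(z, a) \<in> E" "d w a = Suc (d w z)"
    using dist_predecessor[OF w(1) pendant_verts(1) w(2)] by blast
  obtain y where y: "(y, b) \<in> E" "d w b = Suc (d w y)"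
    using dist_predecessor[OF w(1) pendant_verts(2) w(3)] by blast
  have le: "d w a \<le> Suc (d w c)" using dist_arc(1)[OF pendant_arcs(3) w(1)] .
  consider "z = c" | "z = b" "y = a" | "z = b" "y = c"
    using pendant_neighbours(3)[OF z(1)] pendant_neighbours(4)[OF y(1)] by blast
  then show ?thesis
  proof cases
    case 1
    then show ?thesis using z(2) by simp
  next
    case 2
    then show ?thesis using z(2) y(2) by (metis Suc_n_not_le_n le_SucI le_refl)
  next
    case 3
    then have "d w a = Suc (Suc (d w c))" using z(2) y(2) by metis
    then show ?thesis using le by simp
  qed
qed

definition remainder_arcs :: "('a \<times> 'a) set" where
  "remainder_arcs = E - triangle_arcs a b c"

lemma remainder_arcs_verts:
  "(u, v) \<in> remainder_arcs \<longleftrightarrow> (u, v) \<in> E \<and> u \<notin> {a, b} \<and> v \<notin> {a, b}"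
  using pendant_neighbours[of u] pendant_neighbours[of v] pendant_verts no_loops'
  by (auto simp: remainder_arcs_def triangle_arcs_def)

lemma remainder_sym: "(u, v) \<in> remainder_arcs \<Longrightarrow> (v, u) \<in> remainder_arcs"
  using arcs_symmetric by (auto simp: remainder_arcs_verts)

lemma remainder_predecessor:
  assumes "(z, t) \<in> E" "t \<in> V - {a, b}" "d c z < d c t"
  shows "(z, t) \<in> remainder_arcs"
proof -
  have "z \<noteq> a" "z \<noteq> b"
    using assms pendant_neighbours(1,2)[of t] pendant_verts by auto
  then show ?thesis using assms by (simp add: remainder_arcs_verts)
qed

text \<open>Predecessors are followed back to \<open>c\<close>. The condition on heads survives the
  induction because it only weakens as \<open>t\<close> moves away from \<open>c\<close>; it is what
  allows an arc to be deleted afterwards.\<close>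

lemma remainder_reachable:
  assumes "t \<in> V - {a, b}"
  shows "(c, t) \<in> {(x, y) \<in> remainder_arcs. d c x < d c y \<and> (y = t \<or> d c y < d c t)}\<^sup>*"
    (is "_ \<in> (?F t)\<^sup>*")
  using assms
proof (induction "d c t" arbitrary: t rule: less_induct)
  case less
  show ?case
  proof (cases "t = c")
    case False
    then obtain z where z: "(z, t) \<in> E" "d c t = Suc (d c z)"
      using dist_predecessor pendant_verts less.prems by (metis DiffD1)
    then have zt: "(z, t) \<in> remainder_arcs" using remainder_predecessor less.prems by simp
    then have "z \<in> V - {a, b}" using z in_arcsD1 by (simp add: remainder_arcs_verts)
    then have "(c, z) \<in> (?F z)\<^sup>*" using less.hyps[of z] z(2) by simp
    moreover have "?F z \<subseteq> ?F t" using z(2) by auto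
    ultimately have "(c, z) \<in> (?F t)\<^sup>*" using rtrancl_mono by blast
    moreover have "(z, t) \<in> ?F t" using zt z(2) by simp
    ultimately show ?thesis by (rule rtrancl_into_rtrancl)
  qed simp
qed

text \<open>A geodesic from \<open>c\<close> to \<open>t\<close> avoids every other vertex that is at least as far from \<open>c\<close>.\<close>

lemma remainder_reachable_avoiding:
  assumes "t \<in> V - {a, b}" "d c t \<le> d c v" "t \<noteq> v"
  shows "(c, t) \<in> (remainder_arcs - {(u, v), (v, u)})\<^sup>*"
proof -
  have "{(x, y) \<in> remainder_arcs. d c x < d c y \<and> (y = t \<or> d c y < d c t)}
      \<subseteq> remainder_arcs - {(u, v), (v, u)}"
    using assms(2,3) by auto
  then show ?thesis using remainder_reachable[OF assms(1)] rtrancl_mono by blast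
qed

lemma remainder_pair_graph:
  assumes "pverts T = V - {a, b}" "parcs T = remainder_arcs"
  shows "pair_graph T"
proof unfold_locales
  show "fst e \<in> pverts T" "snd e \<in> pverts T" "fst e \<noteq> snd e" if "e \<in> parcs T" for e
  proof -
    obtain u v where e: "e = (u, v)" by (cases e)
    then have "(u, v) \<in> E" "u \<notin> {a, b}" "v \<notin> {a, b}"
      using that assms(2) remainder_arcs_verts by blast+
    then show "fst e \<in> pverts T" "snd e \<in> pverts T" "fst e \<noteq> snd e"
      using in_arcsD1 in_arcsD2 no_loops' e assms(1) by auto
  qed
  show "finite (pverts T)" "finite (parcs T)" using assms by (simp_all add: remainder_arcs_def)
  show "symmetric (with_proj T)"
    unfolding symmetric_def with_proj_simps assms by (rule symI) (rule remainder_sym)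
qed

lemma remainder_connected:
  assumes "pverts T = V - {a, b}" "parcs T = remainder_arcs"
  shows "Digraph_Component.connected (with_proj T)"
proof -
  have reach: "(c, t) \<in> remainder_arcs\<^sup>*" if "t \<in> V - {a, b}" for t
  proof -
    have "{(x, y) \<in> remainder_arcs. d c x < d c y \<and> (y = t \<or> d c y < d c t)} \<subseteq> remainder_arcs"
      by blast
    then show ?thesis using remainder_reachable[OF that] rtrancl_mono by blast
  qed
  have "sym (remainder_arcs\<^sup>*)"
    by (rule sym_rtrancl, rule symI, erule remainder_sym)
  then have "(u, v) \<in> remainder_arcs\<^sup>*" if "u \<in> V - {a, b}" "v \<in> V - {a, b}" for u v
    using reach that by (meson rtrancl_trans symD)
  moreover have "c \<in> V - {a, b}" using pendant_verts by simp
  ultimately show ?thesis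
    unfolding connected_iff_rtrancl[OF remainder_pair_graph[OF assms]] assms by blast
qed

text \<open>At a vertex \<open>w\<close> of the cycle farthest from \<open>c\<close>, both cycle
  neighbours are strictly closer by \<open>level\<close>. They are two different predecessors of
  \<open>w\<close>, against \<open>unique\<close>.\<close>

lemma remainder_acyclic:
  assumes T: "pverts T = V - {a, b}" "parcs T = remainder_arcs"
    and level: "\<And>u v. (u, v) \<in> remainder_arcs \<Longrightarrow> d c u \<noteq> d c v"
    and unique: "\<And>y z w. (y, w) \<in> E \<Longrightarrow> (z, w) \<in> E \<Longrightarrow> d c w = Suc (d c y) \<Longrightarrow>
      d c w = Suc (d c z) \<Longrightarrow> y = z"
  shows "\<not> undirected_cycle T p"
proof
  assume p: "undirected_cycle T p"
  interpret T: pair_graph T by (rule remainder_pair_graph[OF T])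
  have "set p \<subseteq> remainder_arcs" "p \<noteq> []"
    using p T by (auto simp: undirected_cycle_def T.cycle_def T.awalk_def)
  define m where "m = Max ((\<lambda>e. d c (snd e)) ` set p)"
  have "m \<in> (\<lambda>e. d c (snd e)) ` set p" unfolding m_def using \<open>p \<noteq> []\<close> by (intro Max_in) auto
  then obtain y w where yw: "(y, w) \<in> set p" "d c w = m" by auto
  have max: "d c v \<le> d c w" if "(u, v) \<in> set p" for u v
    using that yw(2) unfolding m_def by (auto intro!: Max_ge image_eqI[of _ _ "(u, v)"])
  obtain x z where xz: "z \<noteq> y" "(x, y) \<in> set p" "(w, z) \<in> set p"
    using undirected_cycle_turn[OF T.pair_graph p yw(1)] by blast
  have arcs: "(y, w) \<in> remainder_arcs" "(z, w) \<in> remainder_arcs"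
    using yw xz \<open>set p \<subseteq> remainder_arcs\<close> remainder_sym by blast+
  then have E: "(y, w) \<in> E" "(z, w) \<in> E" by (auto simp: remainder_arcs_verts)
  have "d c y < d c w" "d c z < d c w"
    using max[OF xz(2)] max[OF xz(3)] level[OF arcs(1)] level[OF arcs(2)] by linarith+
  then have "d c w = Suc (d c y)" "d c w = Suc (d c z)"
    using dist_arc(2)[OF E(1) pendant_verts(3)] dist_arc(2)[OF E(2) pendant_verts(3)] by linarith+
  then show False using unique[OF E] xz(1) by blast
qed

context
  fixes T :: "'a pair_pre_digraph"
  assumes T: "pair_graph T" "parcs T = remainder_arcs"
    and acyclic: "\<nexists>p. undirected_cycle T p"
begin

text \<open>Joined at \<open>c\<close>, the two walks lead from \<open>v\<close> to \<open>u\<close>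
  without the edge \<open>uv\<close>, which then closes a cycle in the tree.\<close>

lemma tree_bridge:
  assumes uv: "(u, v) \<in> remainder_arcs"
    and reach: "(c, u) \<in> (remainder_arcs - {(u, v), (v, u)})\<^sup>*"
      "(c, v) \<in> (remainder_arcs - {(u, v), (v, u)})\<^sup>*"
  shows False
proof -
  have "sym ((remainder_arcs - {(u, v), (v, u)})\<^sup>*)"
    by (rule sym_rtrancl, rule symI) (auto intro: remainder_sym)
  then have "(v, u) \<in> (remainder_arcs - {(u, v), (v, u)})\<^sup>*"
    using reach by (meson rtrancl_trans symD)
  then show False
    using undirected_cycle_if_reachable[OF T(1)] uv acyclic unfolding T(2) by blast
qed

text \<open>A horizontal arc of the remainder would have both ends on geodesics from
  \<open>c\<close> that do not use it, against \<open>tree_bridge\<close>.\<close>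

lemma horizontal_root: "horizontal c = {(a, b), (b, a)}"
proof
  show "{(a, b), (b, a)} \<subseteq> horizontal c"
    using pendant_arcs pendant_dist1 by (simp add: horizontal_def)
  show "horizontal c \<subseteq> {(a, b), (b, a)}"
  proof (rule subrelI)
    fix u v assume uv: "(u, v) \<in> horizontal c"
    then have E: "(u, v) \<in> E" "d c u = d c v" "u \<noteq> v" using no_loops' by (auto simp: horizontal_def)
    show "(u, v) \<in> {(a, b), (b, a)}"
    proof (cases "u \<in> {a, b} \<or> v \<in> {a, b}")
      case True
      moreover have "u \<noteq> c" "v \<noteq> c" using E in_arcsD1 in_arcsD2 pendant_verts by auto
      ultimately show ?thesis using E pendant_neighbours by blast
    next
      case False
      then have R: "(u, v) \<in> remainder_arcs" "u \<in> V - {a, b}" "v \<in> V - {a, b}"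
        using E in_arcsD1 in_arcsD2 by (auto simp: remainder_arcs_verts)
      then show ?thesis
        using tree_bridge[OF R(1)] remainder_reachable_avoiding[of u v u]
          remainder_reachable_avoiding[of v u v] E by (simp add: insert_commute)
    qed
  qed
qed

text \<open>If \<open>v\<close> had two predecessors \<open>u\<close> and \<open>u'\<close>, then
  \<open>v\<close> could be reached through \<open>u'\<close> and \<open>u\<close> by a geodesic,
  both without the edge \<open>uv\<close>, against \<open>tree_bridge\<close>.\<close>

lemma inj_ascending_root: "inj_on snd (ascending c)"
proof -
  have "u = u'" if "(u, v) \<in> ascending c" "(u', v) \<in> ascending c" for u u' v
  proof -
    have E: "(u, v) \<in> E" "d c u < d c v" "(u', v) \<in> E" "d c u' < d c v"
      using that by (auto simp: ascending_def)
    have V: "u \<in> V" "u' \<in> V" "v \<in> V" using E in_arcsD1 in_arcsD2 by auto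
    show ?thesis
    proof (cases "v = a \<or> v = b")
      case True
      have "w = c" if "(w, v) \<in> E" "d c w < d c v" for w
        using True that pendant_neighbours(3,4)[of w] pendant_dist1 by auto
      then show ?thesis using E by metis
    next
      case False
      then have R: "(u, v) \<in> remainder_arcs" "(u', v) \<in> remainder_arcs"
        using remainder_predecessor E V by auto
      then have uu': "u \<in> V - {a, b}" "u' \<in> V - {a, b}" using V by (auto simp: remainder_arcs_verts)
      show ?thesis
      proof (rule ccontr)
        assume "u \<noteq> u'"
        have "(c, u) \<in> (remainder_arcs - {(u, v), (v, u)})\<^sup>*"
          "(c, u') \<in> (remainder_arcs - {(u, v), (v, u)})\<^sup>*"
          using remainder_reachable_avoiding[OF uu'(1), of v u]
            remainder_reachable_avoiding[OF uu'(2), of v u] E by auto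
        moreover have "(u', v) \<in> remainder_arcs - {(u, v), (v, u)}"
          using R \<open>u \<noteq> u'\<close> E by auto
        ultimately show False using tree_bridge[OF R(1)] by (meson rtrancl_into_rtrancl)
      qed
    qed
  qed
  then show ?thesis by (auto simp: inj_on_def)
qed

text \<open>Seen from \<open>c\<close> there are 2 horizontal arcs and \<open>card V - 1\<close>
  ascending ones, each of the latter counted with its reversal.\<close>

lemma card_arcs_tree: "card E = 2 * card V"
proof -
  have "card (horizontal c) = 2" using pendant_verts by (simp add: horizontal_root)
  moreover have "card (ascending c) = card V - 1"
    using card_image[OF inj_ascending_root] snd_ascending[OF pendant_verts(3)] pendant_verts by simp
  moreover have "0 < card V" using pendant_verts by (auto simp: card_gt_0_iff)
  ultimately show ?thesis using card_arcs_eq[of c] by simp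
qed

end

end

end

section \<open>Graphs with as many edges as vertices\<close>

context nonbipartite_connected_graph
begin

text \<open>In \<open>card_arcs_eq\<close> the horizontal arcs number at least 2 and the ascending
  ones at least \<open>card V - 1\<close>, so the edge count makes both tight. What was known at the
  root \<open>c\<close> now holds at every vertex.\<close>

lemma unicyclic:
  assumes "card E = 2 * card V" "x \<in> V"
  shows "card (horizontal x) = 2" "inj_on snd (ascending x)"
proof -
  have "card V - 1 = card (snd ` ascending x)" using snd_ascending assms(2) by simp
  moreover have "card (snd ` ascending x) \<le> card (ascending x)" by (rule card_image_le) simp
  moreover have "0 < card V" using assms(2) by (auto simp: card_gt_0_iff)
  ultimately have "card (horizontal x) = 2 \<and> card (snd ` ascending x) = card (ascending x)"
    using card_arcs_eq[of x] card_horizontal_ge[OF horizontal_nonempty[OF assms(2)]] assms(1)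
    by (intro conjI; linarith)
  then show "card (horizontal x) = 2" "inj_on snd (ascending x)"
    by (auto intro: eq_card_imp_inj_on)
qed

context
  fixes a b c
  assumes pendant: "pendant_triangle a b c"
    and arcs_verts: "card E = 2 * card V"
begin

lemmas verts = pendant_verts[OF pendant]
lemmas arcs = pendant_arcs[OF pendant]
lemmas neighbours = pendant_neighbours[OF pendant]
lemmas dist1 = pendant_dist1[OF pendant]

lemma dist_ends:
  assumes "w \<in> V" "w \<noteq> a" "w \<noteq> b"
  shows "d w a = Suc (d w c)" "d w b = Suc (d w c)"
  using assms pendant_dist[OF pendant] pendant_dist[OF pendant_triangle_commute[OF pendant]] by auto

lemma unique_predecessor:
  assumes "x \<in> V" "(u, v) \<in> E" "(u', v) \<in> E" "d x u < d x v" "d x u' < d x v"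
  shows "u = u'"
  using unicyclic(2)[OF arcs_verts assms(1)] assms by (auto simp: inj_on_def ascending_def)

lemma horizontal_eq:
  assumes "x \<in> V" "(s, t) \<in> E" "d x s = d x t"
  shows "horizontal x = {(s, t), (t, s)}"
proof -
  have "s \<noteq> t" using assms no_loops' by blast
  moreover have "{(s, t), (t, s)} \<subseteq> horizontal x"
    using assms arcs_symmetric by (auto simp: horizontal_def)
  ultimately show ?thesis
    using unicyclic(1)[OF arcs_verts assms(1)] card_subset_eq[of "horizontal x" "{(s, t), (t, s)}"] by simp
qed

lemma horizontal_a: "horizontal a = {(b, c), (c, b)}"
  using horizontal_eq verts arcs dist1 by metis

lemma horizontal_b: "horizontal b = {(a, c), (c, a)}"
  using horizontal_eq verts arcs dist1 by metis

lemma horizontal_other: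
  assumes "w \<in> V" "w \<noteq> a" "w \<noteq> b"
  shows "horizontal w = {(a, b), (b, a)}"
  using horizontal_eq[OF assms(1) arcs(1)] dist_ends[OF assms] by simp

text \<open>The vertices \<open>a\<close> and \<open>b\<close> differ from each other and from the
  \<open>card V - 2\<close> remaining vertices, which all agree: \<open>4 * (card V - 2) + 2\<close>
  ordered pairs.\<close>

lemma card_distinct_pairs: "card distinct_pairs + 6 = 4 * card V"
proof -
  let ?R = "V - {a, b}"
  have "distinct_pairs = {a, b} \<times> ?R \<union> ?R \<times> {a, b} \<union> {(a, b), (b, a)}"
  proof -
    have ne: "horizontal a \<noteq> horizontal b" "horizontal a \<noteq> {(a, b), (b, a)}"
      "horizontal b \<noteq> {(a, b), (b, a)}"
      using verts unfolding horizontal_a horizontal_b by (auto simp: doubleton_eq_iff)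
    have hor: "horizontal x = (if x = a then horizontal a else if x = b then horizontal b
        else {(a, b), (b, a)})" if "x \<in> V" for x
      using that horizontal_other by simp
    have "(x, y) \<in> distinct_pairs \<longleftrightarrow>
        (x, y) \<in> {a, b} \<times> ?R \<union> ?R \<times> {a, b} \<union> {(a, b), (b, a)}" for x y
    proof (cases "x \<in> V \<and> y \<in> V")
      case True
      then have "(x, y) \<in> distinct_pairs \<longleftrightarrow> horizontal x \<noteq> horizontal y"
        by (simp add: distinct_pairs_def)
      also have "\<dots> \<longleftrightarrow> (x = a \<and> y \<noteq> a) \<or> (x = b \<and> y \<noteq> b) \<or> (y = a \<and> x \<noteq> a) \<or> (y = b \<and> x \<noteq> b)"
        using ne hor[of x] hor[of y] True by (metis (full_types))
      finally show ?thesis using True verts by auto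
    qed (use verts in \<open>auto simp: distinct_pairs_def\<close>)
    then show ?thesis by (intro set_eqI) (metis surj_pair)
  qed
  moreover have "card ({a, b} \<times> ?R \<union> ?R \<times> {a, b} \<union> {(a, b), (b, a)}) =
      card ({a, b} \<times> ?R) + card (?R \<times> {a, b}) + card {(a, b), (b, a)}"
    using verts by (subst card_Un_disjoint; (subst card_Un_disjoint)?) auto
  moreover have "card ?R = card V - 2" "2 < card V"
  proof -
    show "card ?R = card V - 2" using verts by (simp add: card_Diff_subset)
    have "card {a, b, c} \<le> card V" using verts by (intro card_mono) auto
    then show "2 < card V" using verts by simp
  qed
  ultimately show ?thesis using verts by (simp add: card_cartesian_product)
qed

lemma card_horizontal_Un:
  assumes "x \<in> V" "y \<in> V"
  shows "card (horizontal x \<union> horizontal y) = 2 + 2 * of_bool (horizontal x \<noteq> horizontal y)"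
proof -
  have "card (horizontal x \<union> horizontal y) \<le> 4"
    using card_Un_le[of "horizontal x" "horizontal y"] unicyclic(1)[OF arcs_verts] assms by simp
  then show ?thesis
    using pair_term_ge[OF assms] unicyclic(1)[OF arcs_verts] assms
    by (cases "horizontal x = horizontal y") simp_all
qed

text \<open>The only arc from the side of \<open>u\<close> to the side of \<open>v\<close> is
  \<open>(u, v)\<close>. If \<open>s\<close> were not \<open>v\<close>, a predecessor
  \<open>z\<close> of \<open>s\<close> as seen from \<open>v\<close> would also be closer to
  \<open>u\<close> than \<open>s\<close>. Uniqueness gives \<open>z = r\<close>, but
  \<open>r\<close> is farther from \<open>v\<close> than \<open>s\<close>.\<close>

lemma crossing_arc:
  assumes "(u, v) \<in> E" "(r, s) \<in> E" "d r u < d r v" "d s v < d s u"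
  shows "r = u \<and> s = v"
proof -
  have V: "u \<in> V" "v \<in> V" "r \<in> V" "s \<in> V" using assms in_arcsD1 in_arcsD2 by auto
  have sym: "d r u = d u r" "d r v = d v r" "d s u = d u s" "d s v = d v s"
    using dist_sym V by auto
  have bounds: "d r v \<le> Suc (d r u)" "d s u \<le> Suc (d s v)" "d u s \<le> Suc (d u r)" "d v r \<le> Suc (d v s)"
    using dist_arc[OF assms(1)] dist_arc[OF assms(2)] V by auto
  then have eq: "d u s = Suc (d u r)" "d v r = Suc (d v s)" "d v s = d u r" using assms sym by linarith+
  have "s = v"
  proof (rule ccontr)
    assume "s \<noteq> v"
    then obtain z where z: "(z, s) \<in> E" "d v s = Suc (d v z)"
      using dist_predecessor V by metis
    have zV: "z \<in> V" using z in_arcsD1 by auto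
    have "d u z \<le> Suc (d v z)"
      using dist_arc(1)[OF assms(1) zV] dist_sym zV V by simp
    then have "d u z < d u s" "d u r < d u s" using z eq by auto
    then have "z = r" using unique_predecessor[OF V(1) z(1) assms(2)] by blast
    then show False using z eq by simp
  qed
  then have "d u r = 0" using eq V by simp
  then show ?thesis using V \<open>s = v\<close> by simp
qed

text \<open>Going back from \<open>y\<close> along a geodesic to \<open>x\<close>, the side of
  \<open>v\<close> is left at some arc. No vertex is equidistant, so this arc leads over from the
  side of \<open>u\<close> and is \<open>(u, v)\<close> by \<open>crossing_arc\<close>.\<close>

lemma separating_geodesic_plain:
  assumes uv: "(u, v) \<in> E" and no_horizontal: "\<And>w. w \<in> V \<Longrightarrow> d w u \<noteq> d w v"
    and "x \<in> V" "y \<in> V" "d x u < d x v" "d y v < d y u"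
  shows "d x y = Suc (d x u + d v y)"
  using assms(4,6)
proof (induction "d x y" arbitrary: y rule: less_induct)
  case less
  have V: "u \<in> V" "v \<in> V" using uv in_arcsD1 in_arcsD2 by auto
  have "x \<noteq> y" using assms less.prems by auto
  then obtain z where z: "(z, y) \<in> E" "d x y = Suc (d x z)"
    using dist_predecessor assms(3) less.prems by metis
  have zV: "z \<in> V" using z in_arcsD1 by auto
  show ?case
  proof (cases "d z v < d z u")
    case True
    then have "d x z = Suc (d x u + d v z)" using less.hyps[of z] z zV by simp
    moreover have "d v y \<le> Suc (d v z)" using dist_arc(2)[OF z(1) V(2)] .
    moreover have "d x y \<le> d x v + d v y" "d x v \<le> Suc (d x u)"
      using dist_triangle dist_arc(2)[OF uv] assms(3) V less.prems by auto
    ultimately show ?thesis using z by simp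
  next
    case False
    then have "d z u < d z v" using no_horizontal[OF zV] by simp
    then have "z = u \<and> y = v" using crossing_arc[OF uv z(1)] less.prems by blast
    then show ?thesis using z V by simp
  qed
qed

text \<open>Only \<open>a\<close> itself is closer to \<open>a\<close> than to a neighbour of
  \<open>a\<close>, and likewise for \<open>b\<close>; so an arc at \<open>a\<close> or
  \<open>b\<close> separates only pairs with that vertex as an end. Every other arc is horizontal to
  no vertex, and the plain case applies.\<close>

lemma separating_geodesic:
  assumes "x \<in> V" "y \<in> V" "(u, v) \<in> separating x y"
  shows "d x y = Suc (d x u + d v y)"
proof -
  have uv: "(u, v) \<in> E" "d x u < d x v" "d y v < d y u" using assms(3) by (auto simp: separating_def)
  have V: "u \<in> V" "v \<in> V" using uv in_arcsD1 in_arcsD2 by auto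
  have near_a: "w = a" if "w \<in> V" "(a, t) \<in> E" "d w a < d w t" for w t
  proof (rule ccontr)
    assume "w \<noteq> a"
    moreover have "t = b \<or> t = c" using neighbours(1) that(2) by blast
    ultimately show False using that(3) dist_ends[OF that(1)] dist1 verts by (cases "w = b") auto
  qed
  have near_b: "w = b" if "w \<in> V" "(b, t) \<in> E" "d w b < d w t" for w t
  proof (rule ccontr)
    assume "w \<noteq> b"
    moreover have "t = a \<or> t = c" using neighbours(2) that(2) by blast
    ultimately show False using that(3) dist_ends[OF that(1)] dist1 verts by (cases "w = a") auto
  qed
  have near: "w = s" if "w \<in> V" "(s, t) \<in> E" "d w s < d w t" "s \<in> {a, b}" for w s t
    using near_a near_b that by blast
  have vu: "(v, u) \<in> E" using uv arcs_symmetric by blast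
  have sym: "d x y = d y x" "d v y = d y v" using dist_sym assms V by auto
  show ?thesis
  proof (cases "u \<in> {a, b} \<or> v \<in> {a, b}")
    case True
    then show ?thesis
    proof
      assume u: "u \<in> {a, b}"
      then have x: "x = u" using near[OF assms(1) uv(1,2)] by simp
      show ?thesis
      proof (cases "v \<in> {a, b}")
        case True
        then have "y = v" using near[OF assms(2) vu uv(3)] by simp
        then show ?thesis using x uv(1) V dist_eq_1_iff by simp
      next
        case False
        then have "v = c" using u uv(1) neighbours by blast
        moreover have "y \<noteq> a" "y \<noteq> b" using uv(3) u dist1 verts \<open>v = c\<close> by auto
        ultimately show ?thesis using dist_ends[OF assms(2)] u x sym V by auto
      qed
    next
      assume v: "v \<in> {a, b}"
      then have y: "y = v" using near[OF assms(2) vu uv(3)] by simp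
      show ?thesis
      proof (cases "u \<in> {a, b}")
        case True
        then have "x = u" using near[OF assms(1) uv(1,2)] by simp
        then show ?thesis using y uv(1) V dist_eq_1_iff by simp
      next
        case False
        then have "u = c" using v uv(1) neighbours by blast
        moreover have "x \<noteq> a" "x \<noteq> b" using uv(2) v dist1 verts \<open>u = c\<close> by auto
        ultimately show ?thesis using dist_ends[OF assms(1)] v y V by auto
      qed
    qed
  next
    case False
    have "d w u \<noteq> d w v" if w: "w \<in> V" for w
    proof
      assume "d w u = d w v"
      then have "(u, v) \<in> horizontal w" using uv by (simp add: horizontal_def)
      then show False
        using False horizontal_a horizontal_b horizontal_other[OF w] uv verts no_loops' by fastforce
    qed
    then show ?thesis using separating_geodesic_plain[OF uv(1)] assms uv by blast
  qed
qed

text \<open>A separating arc lies on a geodesic to \<open>y\<close>. Either it is the last arc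
  \<open>(z, y)\<close>, or the geodesic passes through the unique predecessor \<open>z\<close> and
  the arc already separates \<open>x\<close> from \<open>z\<close>. So each step adds at most one
  arc.\<close>

lemma card_separating_eq:
  assumes "x \<in> V" "y \<in> V"
  shows "card (separating x y) = d x y"
proof (rule antisym)
  show "card (separating x y) \<le> d x y"
    using assms(2)
  proof (induction "d x y" arbitrary: y)
    case 0
    then have "separating x y = {}" using assms(1) by (auto simp: separating_def)
    then show ?case by simp
  next
    case (Suc k)
    then have "x \<noteq> y" using assms by auto
    then obtain z where z: "(z, y) \<in> E" "d x y = Suc (d x z)"
      using dist_predecessor Suc.prems assms(1) by metis
    have zV: "z \<in> V" using z in_arcsD1 by auto
    have "separating x y \<subseteq> insert (z, y) (separating x z)"
    proof (rule subrelI)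
      fix u v assume sep: "(u, v) \<in> separating x y"
      then have uv: "(u, v) \<in> E" "d x u < d x v" "d y v < d y u" by (auto simp: separating_def)
      have V: "u \<in> V" "v \<in> V" using uv in_arcsD1 in_arcsD2 by auto
      have geo: "d x y = Suc (d x u + d v y)" using separating_geodesic[OF assms(1) Suc.prems sep] .
      show "(u, v) \<in> insert (z, y) (separating x z)"
      proof (cases "v = y")
        case True
        then have "u = z" using unique_predecessor[OF assms(1) _ z(1)] uv z(2) by auto
        then show ?thesis using True by simp
      next
        case False
        then obtain t where t: "(t, y) \<in> E" "d v y = Suc (d v t)"
          using dist_predecessor V Suc.prems by metis
        have tV: "t \<in> V" using t in_arcsD1 by auto
        have "d x t \<le> d x v + d v t" "d x v \<le> Suc (d x u)"
          using dist_triangle dist_arc(2)[OF uv(1)] assms(1) V tV by auto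
        then have "d x t < d x y" using geo t(2) by simp
        then have "t = z" using unique_predecessor[OF assms(1) t(1) z(1)] z(2) by simp
        moreover have "d x z \<le> d x u + d u z" using dist_triangle assms(1) V zV by blast
        ultimately have "d v z < d u z" using geo t(2) z(2) by simp
        then have "d z v < d z u" using dist_sym V zV by simp
        then show ?thesis using uv by (simp add: separating_def)
      qed
    qed
    then have "card (separating x y) \<le> card (insert (z, y) (separating x z))" by (intro card_mono) auto
    also have "\<dots> \<le> Suc (card (separating x z))" by (rule card_insert_le_m1) simp_all
    also have "\<dots> \<le> d x y" using Suc.hyps(1)[of z] Suc.hyps(2) z zV by simp
    finally show ?case .
  qed
  show "d x y \<le> card (separating x y)" using card_separating_ge[OF assms] .
qed

end

section \<open>The two directions of the characterization of equality\<close>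

lemma difference_eq_if_triangle_tree:
  assumes C: "cycle_graph 3 C" and T: "tree_graph T" and union: "union_sharing_one_vertex G C T"
  shows "revised_szeged_index G - wiener_index G = ((real (card V))\<^sup>2 + 4 * real (card V) - 6) / 4"
proof -
  have G: "V = pverts C \<union> pverts T" "E = parcs C \<union> parcs T" "parcs C \<inter> parcs T = {}"
  proof -
    have u: "with_proj G = Digraph_Component.union (with_proj C) (with_proj T)"
      using union by (simp add: union_sharing_one_vertex_def)
    show "V = pverts C \<union> pverts T" "E = parcs C \<union> parcs T"
      using arg_cong[OF u, of verts] arg_cong[OF u, of arcs] by (simp_all add: Digraph_Component.union_def)
    show "parcs C \<inter> parcs T = {}" using union by (simp add: union_sharing_one_vertex_def)
  qed
  obtain c where c: "pverts C \<inter> pverts T = {c}" using union by (auto simp: union_sharing_one_vertex_def)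
  obtain a' b' c' where C': "a' \<noteq> b'" "b' \<noteq> c'" "a' \<noteq> c'" "pverts C = {a', b', c'}"
    "parcs C = triangle_arcs a' b' c'" using C by (auto simp: cycle_graph_3_iff)
  have "c \<in> {a', b', c'}" using c C' by blast
  \<comment> \<open>The shared vertex may be any of the three; rotating the labels makes it the last
    one.\<close>
  then obtain a b where abc: "a \<noteq> b" "b \<noteq> c" "a \<noteq> c" "pverts C = {a, b, c}" "parcs C = triangle_arcs a b c"
  proof (elim insertE)
    assume "c = a'"
    then show ?thesis using that[of b' c'] C' by (auto simp: triangle_arcs_def insert_commute)
  next
    assume "c = b'"
    then show ?thesis using that[of c' a'] C' by (auto simp: triangle_arcs_def insert_commute)
  next
    assume "c = c'"
    then show ?thesis using that[of a' b'] C' by simp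
  qed simp
  interpret T: pair_graph T using T by (simp add: tree_graph_def)
  have not_T: "a \<notin> pverts T" "b \<notin> pverts T" using c abc by auto
  have "w \<in> {b, c}" if "(a, w) \<in> E" for w
    using that not_T T.in_arcsD1 abc unfolding G(2) by (auto simp: triangle_arcs_def)
  moreover have "w \<in> {a, c}" if "(b, w) \<in> E" for w
    using that not_T T.in_arcsD1 abc unfolding G(2) by (auto simp: triangle_arcs_def)
  ultimately have pendant: "pendant_triangle a b c"
    using abc G unfolding pendant_triangle_def by blast
  have "parcs T = remainder_arcs a b c"
    using G abc(5) by (auto simp: remainder_arcs_def[OF pendant])
  then have "card E = 2 * card V"
    using card_arcs_tree[OF pendant] T by (auto simp: tree_graph_def)
  then show ?thesis
    unfolding difference_eq_iff
    using card_distinct_pairs[OF pendant] card_separating_eq[OF pendant] card_horizontal_Un[OF pendant] by blast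
qed

text \<open>The remainder is a tree because \<open>c\<close> meets both conditions of
  \<open>remainder_acyclic\<close>: its only horizontal edge is \<open>ab\<close>, and two
  predecessors would yield too many separating arcs.\<close>

lemma triangle_tree_if_difference_eq:
  assumes n: "4 \<le> card V"
    and eq: "revised_szeged_index G - wiener_index G = ((real (card V))\<^sup>2 + 4 * real (card V) - 6) / 4"
  shows "\<exists>C T. cycle_graph 3 C \<and> tree_graph T \<and> card (pverts T) = card V - 2 \<and>
    union_sharing_one_vertex G C T"
proof -
  \<comment> \<open>The fact \<open>hor\<close> is the condition on pairs at
    \<open>y = x\<close>.\<close>
  have pairs: "card distinct_pairs + 6 = 4 * card V"
    and sep: "\<And>x y. x \<in> V \<Longrightarrow> y \<in> V \<Longrightarrow> card (separating x y) = d x y"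
    and hor: "\<And>x. x \<in> V \<Longrightarrow> card (horizontal x) = 2"
    using eq unfolding difference_eq_iff by (blast, blast, fastforce)
  obtain a b c where abc: "a \<in> V" "b \<in> V" "c \<in> V" "a \<noteq> b" "b \<noteq> c" "a \<noteq> c"
    and ha: "horizontal a = {(b, c), (c, b)}" and hb: "horizontal b = {(a, c), (c, a)}"
    and hw: "\<And>w. w \<in> V - {a, b} \<Longrightarrow> horizontal w = {(a, b), (b, a)}"
    using extremal_triangle[OF n pairs hor] by metis
  have hc: "horizontal c = {(a, b), (b, a)}" using hw abc by simp
  have tri: "triangle_arcs a b c \<subseteq> E"
  proof -
    have "horizontal a \<union> horizontal b \<union> horizontal c \<subseteq> E" by (auto simp: horizontal_def)
    then show ?thesis unfolding ha hb hc triangle_arcs_def by auto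
  qed
  text \<open>A third neighbour \<open>w\<close> of \<open>a\<close> would also be adjacent to \<open>b\<close>, and \<open>wb\<close> would be horizontal to \<open>a\<close>.\<close>
  have third: "w = t \<or> w = c"
    if st: "s \<in> {a, b}" "t \<in> {a, b}" "s \<noteq> t" and sw: "(s, w) \<in> E" for s t w
  proof (rule ccontr)
    assume w: "\<not> (w = t \<or> w = c)"
    have "w \<noteq> s" using sw no_loops' by blast
    then have wV: "w \<in> V - {a, b}" using w sw st in_arcsD2 by auto
    then have "(a, b) \<in> horizontal w" using hw by blast
    then have "d w s = d w t" using st by (auto simp: horizontal_def)
    moreover have "d w s = 1" using sw arcs_symmetric wV st abc dist_eq_1_iff by blast
    ultimately have wt: "(w, t) \<in> E" using wV st abc dist_eq_1_iff by auto
    moreover have "d s w = 1" "d s t = 1"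
      using sw st abc tri wV dist_eq_1_iff by (auto simp: triangle_arcs_def)
    ultimately have "(w, t) \<in> horizontal s" by (simp add: horizontal_def)
    then show False using ha hb st wV w by auto
  qed
  have pendant: "pendant_triangle a b c"
    using abc tri third[of a b] third[of b a] unfolding pendant_triangle_def by blast
  define C where "C = \<lparr>pverts = {a, b, c}, parcs = triangle_arcs a b c\<rparr>"
  define T where "T = \<lparr>pverts = V - {a, b}, parcs = remainder_arcs a b c\<rparr>"
  have T: "pverts T = V - {a, b}" "parcs T = remainder_arcs a b c" by (simp_all add: T_def)
  have "\<not> undirected_cycle T p" for p
  proof (rule remainder_acyclic[OF pendant T])
    fix u v assume uv: "(u, v) \<in> remainder_arcs a b c"
    show "d c u \<noteq> d c v"
    proof
      assume "d c u = d c v"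
      then have "(u, v) \<in> horizontal c"
        using uv by (simp add: horizontal_def remainder_arcs_def[OF pendant])
      then show False using uv hc by (auto simp: remainder_arcs_verts[OF pendant])
    qed
  next
    fix y z w
    assume *: "(y, w) \<in> E" "(z, w) \<in> E" "d c w = Suc (d c y)" "d c w = Suc (d c z)"
    show "y = z"
    proof (rule ccontr)
      assume "y \<noteq> z"
      then have "d c w < card (separating c w)" using card_separating_gt[OF abc(3) *(1,2)] * by blast
      then show False using sep[OF abc(3)] * in_arcsD2 by fastforce
    qed
  qed
  then have "tree_graph T"
    using remainder_pair_graph[OF pendant T] remainder_connected[OF pendant T]
    by (simp add: tree_graph_def)
  moreover have "cycle_graph 3 C" unfolding cycle_graph_3_iff C_def using abc by auto
  moreover have "card (pverts T) = card V - 2" using abc by (simp add: T_def card_Diff_subset)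
  moreover have "union_sharing_one_vertex G C T"
  proof -
    have "parcs C \<union> parcs T = E" "parcs C \<inter> parcs T = {}"
      using tri by (auto simp: C_def T_def remainder_arcs_def[OF pendant])
    moreover have "pverts C \<union> pverts T = V" "pverts C \<inter> pverts T = {c}"
      using abc by (auto simp: C_def T_def)
    ultimately show ?thesis
      unfolding union_sharing_one_vertex_def Digraph_Component.union_def
      by (simp add: with_proj_def)
  qed
  ultimately show ?thesis by blast
qed

end

theorem theorem2p6:
  fixes G :: "'a pair_pre_digraph" and n :: nat
  assumes "pair_graph G"
    and "Digraph_Component.connected (with_proj G)"
    and "\<not> bipartite_graph G"
    and "card (pverts G) = n"
    and "n \<ge> 4"
  shows "revised_szeged_index G - wiener_index G \<ge> ((real n)\<^sup>2 + 4 * real n - 6) / 4 \<and>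
    (revised_szeged_index G - wiener_index G = ((real n)\<^sup>2 + 4 * real n - 6) / 4 \<longleftrightarrow>
      (\<exists>C T. cycle_graph 3 C \<and> tree_graph T \<and> card (pverts T) = n - 2 \<and>
        union_sharing_one_vertex G C T))"
proof -
  interpret nonbipartite_connected_graph G
    using assms(1-3)
    by (simp add: nonbipartite_connected_graph_def connected_pair_graph_def
        connected_pair_graph_axioms_def nonbipartite_connected_graph_axioms_def)
  show ?thesis
    using difference_ge triangle_tree_if_difference_eq difference_eq_if_triangle_tree assms(4,5) by blast
qed

end
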